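(* Let $\beta\in\left(0,\frac{\beta_c}{2}\right)$ and $\gamma=(\beta_c/\beta)^2$. There exist constants $c'>0$ and $C'>0$ such that for all $x\ge 0$, $$\mathbb{P}(Z_\beta<-x)\ \le\ C'\,e^{-c' x^{\gamma}}.$$
   Context: Let $\mathbb T=\bigcup_{n\ge 0}\{0,1\}^n$ be the binary tree, with $\{0,1\}^0=\{\varnothing\}$. For $u\in\mathbb T$, $|u|$ is the length of $u$, and $v\le u$ means that $v$ is an ancestor (prefix) of $u$ (possibly $u$ itself). Let $(G_v)_{v\in\mathbb T}$ be i.i.d. standard Gaussian random variables and let $X_u=\sum_{\varnothing<v\le u}G_v$ (so $X_\varnothing=0$). Set $\beta_c=\sqrt{2\log 2}$. For $\beta\in[0,\beta_c)$ define the derivative martingale (with respect to $\mathcal F_n=\sigma(X_u,|u|\le n)$) $$Z_n(\beta)=\frac1{2^n}\sum_{|u|=n}e^{\beta X_u-\frac{\beta^2}{2}n}(X_u-\beta n).$$ It converges almost surely to a limit denoted $Z_\beta$. *)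

theory Defs
  imports "HOL-Probability.Probability" "HOL-Library.Sublist"
begin

definition beta_c :: real
  where "beta_c = sqrt (2 * ln 2)"

text \<open>Vertices of the binary tree are the finite words over \<^typ>\<open>bool\<close>; the root is
  \<^term>\<open>[]\<close>, and \<^term>\<open>prefix v u\<close> says that v is an ancestor of u (or u itself).\<close>

definition iid_std_gaussian :: "'a measure \<Rightarrow> (bool list \<Rightarrow> 'a \<Rightarrow> real) \<Rightarrow> bool"
  where "iid_std_gaussian M G \<longleftrightarrow>
    prob_space.indep_vars M (\<lambda>_. borel) G UNIV \<and>
    (\<forall>v. distributed M lborel (G v) std_normal_density)"

definition walk :: "(bool list \<Rightarrow> 'a \<Rightarrow> real) \<Rightarrow> bool list \<Rightarrow> 'a \<Rightarrow> real"
  where "walk G u \<omega> = (\<Sum>v | strict_prefix [] v \<and> prefix v u. G v \<omega>)"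

definition deriv_martingale ::
    "(bool list \<Rightarrow> 'a \<Rightarrow> real) \<Rightarrow> real \<Rightarrow> nat \<Rightarrow> 'a \<Rightarrow> real"
  where "deriv_martingale G \<beta> n \<omega> =
    1 / 2 ^ n * (\<Sum>u | length u = n.
      exp (\<beta> * walk G u \<omega> - \<beta>\<^sup>2 / 2 * real n) * (walk G u \<omega> - \<beta> * real n))"

text \<open>The pointwise limit. It is an unspecified value where the sequence diverges, which for
  \<open>0 \<le> \<beta> < beta_c\<close> and i.i.d. standard Gaussian weights is a null event.\<close>

definition deriv_limit :: "(bool list \<Rightarrow> 'a \<Rightarrow> real) \<Rightarrow> real \<Rightarrow> 'a \<Rightarrow> real"
  where "deriv_limit G \<beta> \<omega> = lim (\<lambda>n. deriv_martingale G \<beta> n \<omega>)"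

end

theory Submission
  imports Defs
begin

text \<open>Write \<open>W\<^sub>n\<close> for the additive martingale, \<open>Z\<^sub>n\<close> for its derivative, and
  \<open>\<xi>\<^sub>n = W\<^sub>n exp (- \<beta> Z\<^sub>n / W\<^sub>n)\<close>. Since \<open>y \<ge> - exp (- \<beta> y - 1) / \<beta>\<close>, a lower bound for \<open>Z\<^sub>n\<close> follows
  from an upper bound for \<open>\<xi>\<^sub>n\<close>. Convexity of \<open>exp\<close> and the branching property give
  \<open>\<xi> \<le> r (\<xi>' + \<xi>'')\<close> with \<open>r = exp (\<beta>\<^sup>2 / 2) / 2\<close> and \<open>\<xi>'\<close>, \<open>\<xi>''\<close> independent copies of the previous
  generation: the increments on the first edges drop out of this inequality.

  The mean of \<open>\<xi>\<^sub>n\<close> stays bounded: it is controlled on the event that \<open>W\<^sub>n\<close> is not small and \<open>Z\<^sub>n\<close>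
  not very negative, and the complement has probability at most about \<open>exp (\<beta>\<^sup>2) - 1\<close> by the
  Paley-Zygmund inequality, so that the second moment recursion contracts exactly when
  \<open>exp (2 \<beta>\<^sup>2) < 2\<close>, that is, \<open>\<beta> < \<beta>\<^sub>c / 2\<close>. Next, \<open>2 r\<^sup>2 < 1\<close> turns the bounded mean into an
  exponential moment \<open>E exp (\<delta> \<xi>\<^sub>n) \<le> e\<close> uniform in \<open>n\<close>. Iterating the recursion \<open>k\<close> times gives
  \<open>E exp (\<delta> r\<^sup>-\<^sup>k \<xi>\<^sub>n) \<le> exp (2\<^sup>k)\<close>, and the Chernoff bound at level \<open>x \<sim> (2 r)\<^sup>k\<close> yields the
  tail \<open>exp (- 2\<^sup>k)\<close>, where \<open>2\<^sup>k = ((2 r)\<^sup>k)\<^sup>\<gamma>\<close>.\<close>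

section \<open>The Gaussian tree as a product space\<close>

definition gauss :: "real measure"
  where "gauss = density lborel std_normal_density"

definition tree_gauss :: "(bool list \<Rightarrow> real) measure"
  where "tree_gauss = PiM UNIV (\<lambda>_. gauss)"

text \<open>Polymorphic in \<open>'b\<close>: it acts on weight configurations and, in the final
  transfer, on families of random variables.\<close>

definition subtree :: "bool \<Rightarrow> (bool list \<Rightarrow> 'b) \<Rightarrow> bool list \<Rightarrow> 'b"
  where "subtree b g = (\<lambda>u. g (b # u))"

definition graft :: "'b \<times> (bool list \<Rightarrow> 'b) \<times> (bool list \<Rightarrow> 'b) \<Rightarrow> bool list \<Rightarrow> 'b"
  where "graft = (\<lambda>(x, g0, g1) u. case u of [] \<Rightarrow> x | b # v \<Rightarrow> if b then g1 v else g0 v)"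

lemma graft_simps [simp]:
  "graft (x, g0, g1) [] = x"
  "subtree False (graft (x, g0, g1)) = g0"
  "subtree True (graft (x, g0, g1)) = g1"
  by (auto simp: graft_def subtree_def)

lemma sets_gauss [simp, measurable_cong]: "sets gauss = sets borel"
  by (simp add: gauss_def)

lemma space_gauss [simp]: "space gauss = UNIV"
  by (simp add: gauss_def)

interpretation gauss: prob_space gauss
  unfolding gauss_def by (rule prob_space_normal_density) simp

interpretation tree: product_prob_space "\<lambda>_. gauss" "UNIV :: bool list set"
  by unfold_locales

interpretation tree_gauss: prob_space tree_gauss
  unfolding tree_gauss_def by (rule tree.prob_space_axioms)

lemma space_tree_gauss [simp]: "space tree_gauss = UNIV"
  by (simp add: tree_gauss_def space_PiM)

lemma measurable_component_tree [measurable]: "(\<lambda>g. g u) \<in> borel_measurable tree_gauss"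
proof -
  have "(\<lambda>g. g u) \<in> measurable tree_gauss gauss"
    unfolding tree_gauss_def by (rule measurable_component_singleton) simp
  then show ?thesis
    by (simp cong: measurable_cong_sets)
qed

lemma measurable_into_tree:
  assumes "\<And>u. (\<lambda>\<omega>. f \<omega> u) \<in> borel_measurable M"
  shows "f \<in> measurable M tree_gauss"
proof -
  have "(\<lambda>\<omega> u. f \<omega> u) \<in> measurable M (PiM UNIV (\<lambda>_. gauss))"
    by (rule measurable_PiM_single') (use assms in \<open>auto cong: measurable_cong_sets\<close>)
  then show ?thesis
    by (simp add: tree_gauss_def)
qed

lemma measurable_subtree [measurable]: "subtree b \<in> measurable tree_gauss tree_gauss"
  by (rule measurable_into_tree) (simp add: subtree_def)

lemma measurable_graft [measurable]:
  "graft \<in> measurable (gauss \<Otimes>\<^sub>M (tree_gauss \<Otimes>\<^sub>M tree_gauss)) tree_gauss"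
proof (rule measurable_into_tree)
  fix u
  show "(\<lambda>z. graft z u) \<in> borel_measurable (gauss \<Otimes>\<^sub>M (tree_gauss \<Otimes>\<^sub>M tree_gauss))"
  proof (cases u)
    case Nil
    then show ?thesis by (simp add: graft_def case_prod_beta)
  next
    case (Cons b v)
    then show ?thesis by (cases b) (simp_all add: graft_def case_prod_beta)
  qed
qed

lemma emeasure_tree_Collect:
  assumes "finite J" "\<And>u. u \<in> J \<Longrightarrow> A u \<in> sets borel"
  shows "emeasure tree_gauss {g. \<forall>u\<in>J. g u \<in> A u} = (\<Prod>u\<in>J. emeasure gauss (A u))"
  using tree.emeasure_PiM_Collect[of J A] assms
  by (simp add: tree_gauss_def[symmetric])

interpretation two_trees: pair_prob_space tree_gauss tree_gauss ..
interpretation root_trees: pair_prob_space gauss "tree_gauss \<Otimes>\<^sub>M tree_gauss" ..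

text \<open>The branching property of the tree law. A cylinder over finitely many vertices pulls
  back under \<open>graft\<close> to a rectangle, whose mass factors according to the first letter
  of the vertices.\<close>

lemma distr_graft:
  "distr (gauss \<Otimes>\<^sub>M (tree_gauss \<Otimes>\<^sub>M tree_gauss)) tree_gauss graft = tree_gauss"
proof (rule measure_eqI_PiM_infinite[where I = UNIV and M = "\<lambda>_. gauss"])
  let ?P = "gauss \<Otimes>\<^sub>M (tree_gauss \<Otimes>\<^sub>M tree_gauss)"
  show "sets (distr ?P tree_gauss graft) = sets (PiM UNIV (\<lambda>_. gauss))"
    "sets tree_gauss = sets (PiM UNIV (\<lambda>_. gauss))"
    by (simp_all add: tree_gauss_def)
  show "finite_measure (distr ?P tree_gauss graft)"
    by (intro prob_space.finite_measure root_trees.P.prob_space_distr measurable_graft)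
  fix A and J :: "bool list set"
  assume J: "finite J" and A0: "\<And>u. u \<in> J \<Longrightarrow> A u \<in> sets gauss"
  \<comment> \<open>Padding by \<open>UNIV\<close> gives a condition at every vertex, so the root
    need not lie in \<open>J\<close>; the extra factors have mass 1.\<close>
  define A' where "A' u = (if u \<in> J then A u else UNIV)" for u
  have A' [measurable]: "A' u \<in> sets borel" for u
    using A0[of u] by (simp add: A'_def)
  define J' where "J' b = {v. b # v \<in> J}" for b
  have fin: "finite (J' b)" for b
    unfolding J'_def using finite_vimageI[OF J, of "Cons b"] by (simp add: vimage_def)
  have Jsub: "J \<subseteq> insert [] (Cons False ` J' False \<union> Cons True ` J' True)"
  proof
    fix u assume "u \<in> J"
    then show "u \<in> insert [] (Cons False ` J' False \<union> Cons True ` J' True)"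
      by (cases u) (auto simp: J'_def image_iff, metis (full_types))
  qed
  have emb: "prod_emb UNIV (\<lambda>_. gauss) J (Pi\<^sub>E J A) = {g. \<forall>u\<in>J. g u \<in> A' u}"
    by (auto simp: prod_emb_def A'_def space_PiM PiE_def Pi_def)
  let ?E = "\<lambda>b. {g. \<forall>v\<in>J' b. g v \<in> A' (b # v)}"
  have E [measurable]: "?E b \<in> sets tree_gauss" for b
  proof -
    have "?E b = {g \<in> space tree_gauss. \<forall>v\<in>J' b. g v \<in> A' (b # v)}" by simp
    also have "\<dots> \<in> sets tree_gauss"
      using fin[of b] by measurable
    finally show ?thesis .
  qed
  have S: "{g. \<forall>u\<in>J. g u \<in> A' u} \<in> sets tree_gauss"
  proof -
    have "{g. \<forall>u\<in>J. g u \<in> A' u} = {g \<in> space tree_gauss. \<forall>u\<in>J. g u \<in> A' u}" by simp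
    also have "\<dots> \<in> sets tree_gauss"
      using J by measurable
    finally show ?thesis .
  qed
  have pre: "graft -` {g. \<forall>u\<in>J. g u \<in> A' u} \<inter> space ?P = A' [] \<times> (?E False \<times> ?E True)"
  proof -
    have "(\<forall>u\<in>J. graft (x, g0, g1) u \<in> A' u) \<longleftrightarrow> x \<in> A' [] \<and> g0 \<in> ?E False \<and> g1 \<in> ?E True"
      for x g0 g1
    proof
      assume *: "\<forall>u\<in>J. graft (x, g0, g1) u \<in> A' u"
      have "x \<in> A' []"
        using *[rule_format, of "[]"] by (cases "[] \<in> J") (auto simp: A'_def)
      moreover have "g0 \<in> ?E False" "g1 \<in> ?E True"
        using * by (auto simp: J'_def graft_def dest!: bspec)
      ultimately show "x \<in> A' [] \<and> g0 \<in> ?E False \<and> g1 \<in> ?E True" by simp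
    next
      assume "x \<in> A' [] \<and> g0 \<in> ?E False \<and> g1 \<in> ?E True"
      then show "\<forall>u\<in>J. graft (x, g0, g1) u \<in> A' u"
        using Jsub by (auto simp: graft_def)
    qed
    note eq = this
    show ?thesis
    proof (rule set_eqI)
      fix z
      show "z \<in> graft -` {g. \<forall>u\<in>J. g u \<in> A' u} \<inter> space ?P \<longleftrightarrow> z \<in> A' [] \<times> (?E False \<times> ?E True)"
        by (cases z rule: prod_cases3) (simp add: eq space_pair_measure)
    qed
  qed
  have "emeasure (distr ?P tree_gauss graft) {g. \<forall>u\<in>J. g u \<in> A' u}
      = emeasure ?P (A' [] \<times> (?E False \<times> ?E True))"
    by (simp only: emeasure_distr[OF measurable_graft S] pre)
  also have "\<dots> = emeasure gauss (A' []) *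
      (emeasure tree_gauss (?E False) * emeasure tree_gauss (?E True))"
    by (subst two_trees.P.emeasure_pair_measure_Times)
       (auto simp: tree_gauss.emeasure_pair_measure_Times)
  also have "\<dots> = emeasure gauss (A' []) *
      ((\<Prod>v\<in>J' False. emeasure gauss (A' (False # v))) * (\<Prod>v\<in>J' True. emeasure gauss (A' (True # v))))"
    by (subst (1 2) emeasure_tree_Collect) (use fin in auto)
  also have "\<dots> = (\<Prod>u\<in>insert [] (Cons False ` J' False \<union> Cons True ` J' True). emeasure gauss (A' u))"
  proof -
    have "(\<Prod>u\<in>Cons False ` J' False \<union> Cons True ` J' True. emeasure gauss (A' u))
       = (\<Prod>v\<in>J' False. emeasure gauss (A' (False # v))) * (\<Prod>v\<in>J' True. emeasure gauss (A' (True # v)))"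
      by (subst prod.union_disjoint) (auto simp: fin prod.reindex)
    then show ?thesis
      by (subst prod.insert) (auto simp: fin)
  qed
  also have "\<dots> = (\<Prod>u\<in>J. emeasure gauss (A' u))"
    by (rule prod.mono_neutral_right)
       (use Jsub fin in \<open>auto simp: A'_def gauss.emeasure_space_1[simplified]\<close>)
  also have "\<dots> = emeasure tree_gauss {g. \<forall>u\<in>J. g u \<in> A' u}"
    by (subst emeasure_tree_Collect) (use J in auto)
  finally show "emeasure (distr ?P tree_gauss graft) (prod_emb UNIV (\<lambda>_. gauss) J (Pi\<^sub>E J A))
      = emeasure tree_gauss (prod_emb UNIV (\<lambda>_. gauss) J (Pi\<^sub>E J A))"
    by (simp add: emb)
qed

section \<open>Integrals of products over the root and the two subtrees\<close>

lemma (in pair_sigma_finite) has_bochner_integral_pair_mult: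
  fixes f :: "'a \<Rightarrow> real" and h :: "'b \<Rightarrow> real"
  assumes f: "integrable M1 f" and h: "integrable M2 h"
  shows "has_bochner_integral (M1 \<Otimes>\<^sub>M M2) (\<lambda>z. f (fst z) * h (snd z))
    (integral\<^sup>L M1 f * integral\<^sup>L M2 h)"
proof -
  have [measurable]: "f \<in> borel_measurable M1" "h \<in> borel_measurable M2"
    using f h by auto
  have int: "integrable (M1 \<Otimes>\<^sub>M M2) (\<lambda>z. f (fst z) * h (snd z))"
    by (rule Fubini_integrable) (use f h in \<open>auto simp: abs_mult\<close>)
  then show ?thesis
    using integral_fst'[OF int] by (simp add: has_bochner_integral_iff)
qed

lemma has_bochner_integral_branch:
  fixes k :: "real \<Rightarrow> real" and f h :: "(bool list \<Rightarrow> real) \<Rightarrow> real"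
  assumes k: "integrable gauss k" and f: "integrable tree_gauss f" and h: "integrable tree_gauss h"
  shows "has_bochner_integral tree_gauss
    (\<lambda>g. k (g []) * (f (subtree False g) * h (subtree True g)))
    (integral\<^sup>L gauss k * (integral\<^sup>L tree_gauss f * integral\<^sup>L tree_gauss h))"
proof -
  let ?P = "gauss \<Otimes>\<^sub>M (tree_gauss \<Otimes>\<^sub>M tree_gauss)"
  let ?F = "\<lambda>g. k (g []) * (f (subtree False g) * h (subtree True g))"
  have [measurable]: "k \<in> borel_measurable borel" "f \<in> borel_measurable tree_gauss"
      "h \<in> borel_measurable tree_gauss"
    using f h borel_measurable_integrable[OF k] by (auto cong: measurable_cong_sets)
  have "has_bochner_integral (tree_gauss \<Otimes>\<^sub>M tree_gauss) (\<lambda>z. f (fst z) * h (snd z))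
      (integral\<^sup>L tree_gauss f * integral\<^sup>L tree_gauss h)"
    by (rule two_trees.has_bochner_integral_pair_mult[OF f h])
  then have "has_bochner_integral ?P (\<lambda>z. k (fst z) * (f (fst (snd z)) * h (snd (snd z))))
      (integral\<^sup>L gauss k * (integral\<^sup>L tree_gauss f * integral\<^sup>L tree_gauss h))"
    using root_trees.has_bochner_integral_pair_mult[OF k, of "\<lambda>z. f (fst z) * h (snd z)"]
    by (simp add: has_bochner_integral_iff)
  also have "(\<lambda>z. k (fst z) * (f (fst (snd z)) * h (snd (snd z)))) = (\<lambda>z. ?F (graft z))"
    by auto
  finally have "has_bochner_integral ?P (\<lambda>z. ?F (graft z))
      (integral\<^sup>L gauss k * (integral\<^sup>L tree_gauss f * integral\<^sup>L tree_gauss h))" .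
  then have "has_bochner_integral (distr ?P tree_gauss graft) ?F
      (integral\<^sup>L gauss k * (integral\<^sup>L tree_gauss f * integral\<^sup>L tree_gauss h))"
    by (simp add: has_bochner_integral_iff integrable_distr_eq integral_distr)
  then show ?thesis
    by (simp only: distr_graft)
qed

section \<open>Square-integrable functionals\<close>

text \<open>Young's inequality; the free parameter keeps the factor of one square close to
  1.\<close>

lemma power2_sum_le:
  fixes a b \<theta> :: real
  assumes "\<theta> > 0"
  shows "(a + b)\<^sup>2 \<le> (1 + 1 / \<theta>) * a\<^sup>2 + (1 + \<theta>) * b\<^sup>2"
proof -
  have "0 \<le> (\<theta> * b - a)\<^sup>2 / \<theta>" using assms by simp
  also have "\<dots> = (1 + 1 / \<theta>) * a\<^sup>2 + (1 + \<theta>) * b\<^sup>2 - (a + b)\<^sup>2"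
    using assms by (simp add: power2_eq_square field_simps)
  finally show ?thesis by simp
qed

definition avg :: "((bool list \<Rightarrow> real) \<Rightarrow> real) \<Rightarrow> (bool list \<Rightarrow> real) \<Rightarrow> real"
  where "avg P g = (P (subtree False g) + P (subtree True g)) / 2"

definition sq_int :: "((bool list \<Rightarrow> real) \<Rightarrow> real) \<Rightarrow> bool"
  where "sq_int P \<longleftrightarrow> P \<in> borel_measurable tree_gauss \<and> integrable tree_gauss (\<lambda>g. (P g)\<^sup>2)"

lemma sq_int_measurable: "sq_int P \<Longrightarrow> P \<in> borel_measurable tree_gauss"
  and sq_int_sq: "sq_int P \<Longrightarrow> integrable tree_gauss (\<lambda>g. (P g)\<^sup>2)"
  and sq_int_integrable: "sq_int P \<Longrightarrow> integrable tree_gauss P"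
  by (auto simp: sq_int_def intro: tree_gauss.square_integrable_imp_integrable)

lemma sq_int_bound:
  assumes "P \<in> borel_measurable tree_gauss" "integrable tree_gauss F" "\<And>g. (P g)\<^sup>2 \<le> F g"
  shows "sq_int P"
proof -
  have "integrable tree_gauss (\<lambda>g. (P g)\<^sup>2)"
    by (rule Bochner_Integration.integrable_bound[OF assms(2)])
       (use assms in \<open>auto intro: order_trans[OF _ abs_ge_self]\<close>)
  with assms(1) show ?thesis by (simp add: sq_int_def)
qed

lemma sq_int_diff:
  assumes "sq_int P" "sq_int Q"
  shows "sq_int (\<lambda>g. P g - Q g)"
proof (rule sq_int_bound)
  show "integrable tree_gauss (\<lambda>g. 2 * (P g)\<^sup>2 + 2 * (Q g)\<^sup>2)"
    using assms by (intro Bochner_Integration.integrable_add integrable_mult_right sq_int_sq)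
  show "(P g - Q g)\<^sup>2 \<le> 2 * (P g)\<^sup>2 + 2 * (Q g)\<^sup>2" for g
    using zero_le_power2[of "P g + Q g"] by (simp add: power2_eq_square algebra_simps)
qed (use assms[THEN sq_int_measurable] in measurable)

lemma measurable_avg [measurable]:
  assumes [measurable]: "P \<in> borel_measurable tree_gauss"
  shows "avg P \<in> borel_measurable tree_gauss"
proof -
  have "avg P = (\<lambda>g. (P (subtree False g) + P (subtree True g)) / 2)"
    by (auto simp: avg_def)
  then show ?thesis by simp
qed

lemma has_bochner_integral_root_avg:
  assumes k: "has_bochner_integral gauss k c" and P: "integrable tree_gauss P"
  shows "has_bochner_integral tree_gauss (\<lambda>g. k (g []) * avg P g) (c * integral\<^sup>L tree_gauss P)"
proof -
  have k': "integrable gauss k" "integral\<^sup>L gauss k = c"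
    using k by (auto simp: has_bochner_integral_iff)
  have one: "integrable tree_gauss (\<lambda>_. 1 :: real)" by simp
  have "has_bochner_integral tree_gauss (\<lambda>g. (k (g []) * (P (subtree False g) * 1)
      + k (g []) * (1 * P (subtree True g))) / 2)
      ((c * (integral\<^sup>L tree_gauss P * 1) + c * (1 * integral\<^sup>L tree_gauss P)) / 2)"
    using has_bochner_integral_branch[OF k'(1) P one] has_bochner_integral_branch[OF k'(1) one P]
    by (intro has_bochner_integral_divide_zero has_bochner_integral_add)
       (simp_all add: k'(2) tree_gauss.prob_space[simplified])
  then show ?thesis
    by (simp add: avg_def algebra_simps add_divide_distrib)
qed

text \<open>The diagonal terms give half the second moment; the cross term factors by independence
  and gives half the squared mean. All second moment recursions get their factor 1/2 from
  here.\<close>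

lemma has_bochner_integral_root_avg_sq:
  assumes k: "has_bochner_integral gauss k c" and P: "sq_int P"
  shows "has_bochner_integral tree_gauss (\<lambda>g. k (g []) * (avg P g)\<^sup>2)
    (c * (((\<integral>g. (P g)\<^sup>2 \<partial>tree_gauss) + (integral\<^sup>L tree_gauss P)\<^sup>2) / 2))"
proof -
  have k': "integrable gauss k" "integral\<^sup>L gauss k = c"
    using k by (auto simp: has_bochner_integral_iff)
  note P' = sq_int_integrable[OF P]
  have "has_bochner_integral tree_gauss (\<lambda>g. (k (g []) * avg (\<lambda>g. (P g)\<^sup>2) g
      + k (g []) * (P (subtree False g) * P (subtree True g))) / 2)
      ((c * (\<integral>g. (P g)\<^sup>2 \<partial>tree_gauss) +
        c * (integral\<^sup>L tree_gauss P * integral\<^sup>L tree_gauss P)) / 2)"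
    using has_bochner_integral_branch[OF k'(1) P' P']
    by (intro has_bochner_integral_divide_zero has_bochner_integral_add
              has_bochner_integral_root_avg k sq_int_sq P)
       (simp_all add: k'(2))
  then show ?thesis
    by (simp add: avg_def algebra_simps add_divide_distrib power2_eq_square)
qed

section \<open>Gaussian moments and general inequalities\<close>

lemma has_bochner_integral_gauss_const: "has_bochner_integral gauss (\<lambda>_. c) (c :: real)"
  by (simp add: has_bochner_integral_iff gauss.prob_space[simplified])

lemma has_bochner_integral_gauss:
  assumes "f \<in> borel_measurable borel"
    "has_bochner_integral lborel (\<lambda>x. std_normal_density x * f x) (c :: real)"
  shows "has_bochner_integral gauss f c"
  unfolding gauss_def using assms by (intro has_bochner_integral_density) auto

lemma has_bochner_integral_gauss_x: "has_bochner_integral gauss (\<lambda>x. x) 0"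
  by (rule has_bochner_integral_gauss) (use std_normal_moment_odd[of 0] in auto)

lemma has_bochner_integral_gauss_x2: "has_bochner_integral gauss (\<lambda>x. x\<^sup>2) 1"
  by (rule has_bochner_integral_gauss) (use std_normal_moment_even[of 1] in auto)

text \<open>The quadratic polynomial t -> E (X - t Y)^2 is nonnegative, in particular at its
  minimiser \<open>B / C\<close>.\<close>

lemma (in prob_space) Cauchy_Schwarz_expectation:
  fixes X Y :: "'a \<Rightarrow> real"
  assumes X: "integrable M (\<lambda>x. (X x)\<^sup>2)" and Y: "integrable M (\<lambda>x. (Y x)\<^sup>2)"
    and XY: "integrable M (\<lambda>x. X x * Y x)"
  shows "(expectation (\<lambda>x. X x * Y x))\<^sup>2 \<le> expectation (\<lambda>x. (X x)\<^sup>2) * expectation (\<lambda>x. (Y x)\<^sup>2)"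
proof -
  define A B C where "A = expectation (\<lambda>x. (X x)\<^sup>2)" and "B = expectation (\<lambda>x. X x * Y x)"
    and "C = expectation (\<lambda>x. (Y x)\<^sup>2)"
  have *: "0 \<le> A - 2 * t * B + t\<^sup>2 * C" for t
  proof -
    have "0 \<le> expectation (\<lambda>x. (X x - t * Y x)\<^sup>2)"
      by (rule Bochner_Integration.integral_nonneg) simp
    also have "(\<lambda>x. (X x - t * Y x)\<^sup>2) = (\<lambda>x. (X x)\<^sup>2 - 2 * t * (X x * Y x) + t\<^sup>2 * (Y x)\<^sup>2)"
      by (auto simp: power2_eq_square algebra_simps)
    also have "expectation \<dots> = A - 2 * t * B + t\<^sup>2 * C"
      using X Y XY by (simp add: A_def B_def C_def)
    finally show ?thesis .
  qed
  have C: "C \<ge> 0"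
    unfolding C_def by (rule Bochner_Integration.integral_nonneg) simp
  have "B\<^sup>2 \<le> A * C"
  proof (cases "C = 0")
    case True
    have "B = 0"
    proof (rule ccontr)
      assume "B \<noteq> 0"
      \<comment> \<open>With \<open>C = 0\<close> the polynomial is affine and takes the value -1 at
        this point.\<close>
      with *[of "(A + 1) / (2 * B)"] True show False by simp
    qed
    then show ?thesis using True by simp
  next
    case False
    have "A - 2 * (B / C) * B + (B / C)\<^sup>2 * C = A - B\<^sup>2 / C"
      using False by (simp add: power2_eq_square field_simps)
    with *[of "B / C"] have "B\<^sup>2 / C \<le> A" by simp
    then show ?thesis
      using C False by (simp add: field_simps)
  qed
  then show ?thesis by (simp add: A_def B_def C_def)
qed

lemma sq_int_const: "sq_int (\<lambda>_. c)"
  by (simp add: sq_int_def)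

lemma avg_diff: "avg (\<lambda>g. P g - Q g) g = avg P g - avg Q g"
  by (simp add: avg_def diff_divide_distrib add_divide_distrib)

lemma avg_sq:
  assumes "sq_int P"
  shows "sq_int (avg P)" "integral\<^sup>L tree_gauss (avg P) = integral\<^sup>L tree_gauss P"
    "(\<integral>g. (avg P g)\<^sup>2 \<partial>tree_gauss) =
      ((\<integral>g. (P g)\<^sup>2 \<partial>tree_gauss) + (integral\<^sup>L tree_gauss P)\<^sup>2) / 2"
  using has_bochner_integral_root_avg[OF has_bochner_integral_gauss_const sq_int_integrable[OF assms], of 1]
    has_bochner_integral_root_avg_sq[OF has_bochner_integral_gauss_const assms, of 1]
    sq_int_measurable[OF assms]
  by (simp_all add: sq_int_def has_bochner_integral_iff)

text \<open>\<open>K / (1 - \<rho>)\<close> is the fixed point of the affine map, so every level at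
  or above it persists as an upper bound.\<close>

lemma affine_recursion_bounded:
  fixes p :: "nat \<Rightarrow> real"
  assumes "\<And>n. p (Suc n) \<le> \<rho> * p n + K" "0 \<le> \<rho>" "\<rho> < 1"
  shows "p n \<le> max (p 0) (K / (1 - \<rho>))"
proof (induction n)
  case (Suc n)
  let ?m = "max (p 0) (K / (1 - \<rho>))"
  have "K \<le> m * (1 - \<rho>)" if "K / (1 - \<rho>) \<le> m" for m
    using that assms(3) by (simp add: pos_divide_le_eq)
  then have "K \<le> ?m * (1 - \<rho>)"
    using max.cobounded2 .
  moreover have "\<rho> * p n \<le> \<rho> * ?m"
    using Suc assms(2) by (intro mult_left_mono)
  ultimately have "\<rho> * p n + K \<le> ?m"
    by (simp add: algebra_simps)
  then show ?case
    using assms(1)[of n] by linarith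
qed simp

text \<open>The map (a, b) -> a exp (c b / a) is the perspective of a convex function, hence
  subadditive: Jensen with weights proportional to \<open>a0\<close> and \<open>a1\<close>.\<close>

lemma exp_perspective_le:
  fixes a0 a1 b0 b1 c :: real
  assumes "a0 > 0" "a1 > 0"
  shows "(a0 + a1) * exp (c * ((b0 + b1) / (a0 + a1))) \<le> a0 * exp (c * (b0 / a0)) + a1 * exp (c * (b1 / a1))"
proof -
  define p where "p = a1 / (a0 + a1)"
  have p: "0 \<le> p" "p \<le> 1" "1 - p = a0 / (a0 + a1)"
    using assms by (auto simp: p_def field_simps)
  have "exp ((1 - p) *\<^sub>R (c * (b0 / a0)) + p *\<^sub>R (c * (b1 / a1)))
      \<le> (1 - p) * exp (c * (b0 / a0)) + p * exp (c * (b1 / a1))"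
    using p by (intro convex_onD[OF exp_convex]) auto
  moreover have "(1 - p) *\<^sub>R (c * (b0 / a0)) + p *\<^sub>R (c * (b1 / a1)) = c * ((b0 + b1) / (a0 + a1))"
    unfolding p(3) using assms by (simp add: p_def) (simp add: divide_simps, simp add: algebra_simps)
  ultimately have "(a0 + a1) * exp (c * ((b0 + b1) / (a0 + a1)))
      \<le> (a0 + a1) * ((1 - p) * exp (c * (b0 / a0)) + p * exp (c * (b1 / a1)))"
    using assms by (intro mult_left_mono) auto
  also have "\<dots> = a0 * exp (c * (b0 / a0)) + a1 * exp (c * (b1 / a1))"
    unfolding p(3) unfolding p_def using assms by (simp add: distrib_left)
  finally show ?thesis .
qed

lemma Cauchy_Schwarz_event:
  assumes X: "sq_int X" and A: "A \<in> sets tree_gauss"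
  shows "(\<integral>g. X g * indicator A g \<partial>tree_gauss)\<^sup>2 \<le> (\<integral>g. (X g)\<^sup>2 \<partial>tree_gauss) * measure tree_gauss A"
proof -
  have sq: "(\<lambda>g. (indicator A g :: real)\<^sup>2) = indicator A"
    by (auto simp: indicator_def)
  have "integrable tree_gauss (indicator A :: _ \<Rightarrow> real)"
    using A by (simp add: tree_gauss.emeasure_eq_measure)
  then have "(\<integral>g. X g * indicator A g \<partial>tree_gauss)\<^sup>2 \<le>
      (\<integral>g. (X g)\<^sup>2 \<partial>tree_gauss) * (\<integral>g. (indicator A g)\<^sup>2 \<partial>tree_gauss)"
    by (intro tree_gauss.Cauchy_Schwarz_expectation sq_int_sq[OF X]
        integrable_real_mult_indicator[OF A sq_int_integrable[OF X]]) (simp add: sq)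
  then show ?thesis
    using A by (simp add: sq)
qed

section \<open>The martingale and its derivative\<close>

locale branching_walk =
  fixes \<beta> :: real
  assumes beta_pos: "0 < \<beta>" and beta_small: "\<beta> < beta_c / 2"
begin

section \<open>The exponentially tilted Gaussian weight\<close>

definition weight :: "real \<Rightarrow> real"
  where "weight x = exp (\<beta> * x - \<beta>\<^sup>2 / 2)"

lemma weight_pos [simp]: "weight x > 0"
  by (simp add: weight_def)

lemma measurable_weight [measurable]: "weight \<in> borel_measurable borel"
  unfolding weight_def[abs_def] by measurable

lemma weight_shift: "weight (\<beta> + x) = exp (\<beta>\<^sup>2) * weight x"
  unfolding weight_def exp_add[symmetric] by (simp add: algebra_simps power2_eq_square)

text \<open>Cameron-Martin: \<open>weight\<close> is the density, relative to \<open>gauss\<close>,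
  of the Gaussian with mean \<beta> and variance 1.\<close>

lemma has_bochner_integral_weight:
  fixes f :: "real \<Rightarrow> real"
  assumes [measurable]: "f \<in> borel_measurable borel"
    and f: "has_bochner_integral gauss (\<lambda>x. f (\<beta> + x)) c"
  shows "has_bochner_integral gauss (\<lambda>x. weight x * f x) c"
proof (rule has_bochner_integral_gauss)
  have *: "std_normal_density (\<beta> + x) * weight (\<beta> + x) = std_normal_density x" for x
  proof -
    have "- (\<beta> + x)\<^sup>2 / 2 + (\<beta> * (\<beta> + x) - \<beta>\<^sup>2 / 2) = - x\<^sup>2 / 2"
      by (simp add: power2_eq_square field_simps)
    then show ?thesis
      by (simp add: std_normal_density_def weight_def exp_add[symmetric])
  qed
  have "has_bochner_integral lborel (\<lambda>x. std_normal_density x * f (\<beta> + x)) c"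
    using f unfolding gauss_def has_bochner_integral_iff
    by (subst (asm) (1) integrable_density, simp, simp, simp)
       (subst (asm) (1) integral_density, simp_all)
  then have "has_bochner_integral lborel
      (\<lambda>x. std_normal_density (\<beta> + 1 * x) * (weight (\<beta> + 1 * x) * f (\<beta> + 1 * x))) (c /\<^sub>R \<bar>1\<bar>)"
    by (simp only: mult.assoc[symmetric] mult_1 *) simp
  then show "has_bochner_integral lborel (\<lambda>x. std_normal_density x * (weight x * f x)) c"
    by (subst lborel_has_bochner_integral_real_affine_iff[of 1 _ _ \<beta>]) simp_all
qed measurable

lemma has_bochner_integral_weight_1: "has_bochner_integral gauss weight 1"
  using has_bochner_integral_weight[of "\<lambda>_. 1" 1] has_bochner_integral_gauss_const[of 1] by simp

lemma has_bochner_integral_weight_centered: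
  "has_bochner_integral gauss (\<lambda>x. weight x * (x - \<beta>)) 0"
  by (rule has_bochner_integral_weight) (simp_all add: has_bochner_integral_gauss_x)

lemma has_bochner_integral_weight_sq:
  "has_bochner_integral gauss (\<lambda>x. (weight x)\<^sup>2) (exp (\<beta>\<^sup>2))"
proof -
  have "has_bochner_integral gauss (\<lambda>x. weight (\<beta> + x)) (exp (\<beta>\<^sup>2) * 1)"
    unfolding weight_shift by (intro has_bochner_integral_mult_right has_bochner_integral_weight_1)
  then show ?thesis
    using has_bochner_integral_weight[OF measurable_weight] by (simp add: power2_eq_square)
qed

lemma has_bochner_integral_weight_sq_centered:
  "has_bochner_integral gauss (\<lambda>x. (weight x)\<^sup>2 * (x - \<beta>)\<^sup>2) (exp (\<beta>\<^sup>2) * (1 + \<beta>\<^sup>2))"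
proof -
  have "has_bochner_integral gauss (\<lambda>x. (\<beta>\<^sup>2 + 2 * \<beta> * x) + x\<^sup>2) ((\<beta>\<^sup>2 + 2 * \<beta> * 0) + 1)"
    by (intro has_bochner_integral_add has_bochner_integral_mult_right has_bochner_integral_gauss_x
          has_bochner_integral_gauss_x2 has_bochner_integral_gauss_const)
  then have "has_bochner_integral gauss (\<lambda>x. (\<beta> + x)\<^sup>2) (1 + \<beta>\<^sup>2)"
    by (simp add: power2_eq_square algebra_simps)
  then have "has_bochner_integral gauss (\<lambda>x. weight x * x\<^sup>2) (1 + \<beta>\<^sup>2)"
    by (intro has_bochner_integral_weight) simp_all
  then have "has_bochner_integral gauss (\<lambda>x. exp (\<beta>\<^sup>2) * (weight x * x\<^sup>2)) (exp (\<beta>\<^sup>2) * (1 + \<beta>\<^sup>2))"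
    by (rule has_bochner_integral_mult_right)
  then have "has_bochner_integral gauss (\<lambda>x. weight (\<beta> + x) * ((\<beta> + x) - \<beta>)\<^sup>2)
      (exp (\<beta>\<^sup>2) * (1 + \<beta>\<^sup>2))"
    by (simp add: weight_shift mult.assoc)
  then have "has_bochner_integral gauss (\<lambda>x. weight x * (weight x * (x - \<beta>)\<^sup>2))
      (exp (\<beta>\<^sup>2) * (1 + \<beta>\<^sup>2))"
    by (intro has_bochner_integral_weight) simp_all
  then show ?thesis
    by (simp add: power2_eq_square mult.assoc)
qed

section \<open>One generation of the martingale and of its derivative\<close>

definition cas_step :: "((bool list \<Rightarrow> real) \<Rightarrow> real) \<Rightarrow> (bool list \<Rightarrow> real) \<Rightarrow> real"
  where "cas_step Q g = weight (g []) * avg Q g"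

text \<open>The formal derivative of \<open>cas_step Q\<close> in \<beta>, with \<open>P\<close>
  standing for the derivative of \<open>Q\<close>: that of \<open>weight x\<close> is
  \<open>weight x * (x - \<beta>)\<close>.\<close>

definition der_step ::
    "((bool list \<Rightarrow> real) \<Rightarrow> real) \<Rightarrow> ((bool list \<Rightarrow> real) \<Rightarrow> real) \<Rightarrow> (bool list \<Rightarrow> real) \<Rightarrow> real"
  where "der_step P Q g = weight (g []) * (avg P g + (g [] - \<beta>) * avg Q g)"

lemma measurable_weight_root [measurable]: "(\<lambda>g. weight (g [])) \<in> borel_measurable tree_gauss"
  by (rule measurable_compose[OF measurable_component_tree measurable_weight])

lemma measurable_cas_step [measurable]:
  "Q \<in> borel_measurable tree_gauss \<Longrightarrow> cas_step Q \<in> borel_measurable tree_gauss"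
  unfolding cas_step_def[abs_def]
  by (intro borel_measurable_times measurable_weight_root measurable_avg)

lemma measurable_der_step [measurable]:
  "P \<in> borel_measurable tree_gauss \<Longrightarrow> Q \<in> borel_measurable tree_gauss \<Longrightarrow>
    der_step P Q \<in> borel_measurable tree_gauss"
  unfolding der_step_def[abs_def]
  by (intro borel_measurable_times borel_measurable_add borel_measurable_diff measurable_weight_root
      measurable_avg measurable_component_tree borel_measurable_const)

lemma integral_cas_step: "sq_int Q \<Longrightarrow> integral\<^sup>L tree_gauss (cas_step Q) = integral\<^sup>L tree_gauss Q"
  using has_bochner_integral_root_avg[OF has_bochner_integral_weight_1 sq_int_integrable, of Q]
  unfolding cas_step_def[abs_def] by (simp add: has_bochner_integral_iff)

lemma cas_step_sq:
  assumes "sq_int Q"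
  shows "sq_int (cas_step Q)"
    and "(\<integral>g. (cas_step Q g)\<^sup>2 \<partial>tree_gauss) =
      exp (\<beta>\<^sup>2) * (((\<integral>g. (Q g)\<^sup>2 \<partial>tree_gauss) + (integral\<^sup>L tree_gauss Q)\<^sup>2) / 2)"
  using has_bochner_integral_root_avg_sq[OF has_bochner_integral_weight_sq assms]
    sq_int_measurable[OF assms]
  by (simp_all add: sq_int_def has_bochner_integral_iff cas_step_def power_mult_distrib)

text \<open>Young's inequality decouples the two summands: a small \<open>\<eta>\<close> keeps the
  factor of the \<open>P\<close> term near \<open>exp (\<beta>\<^sup>2) / 2\<close>, at the price of
  a large factor for \<open>Q\<close>.\<close>

lemma der_step_sq:
  assumes P: "sq_int P" and Q: "sq_int Q"
  shows sq_int_der_step: "sq_int (der_step P Q)"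
    and "\<eta> > 0 \<Longrightarrow> (\<integral>g. (der_step P Q g)\<^sup>2 \<partial>tree_gauss) \<le>
      (1 + \<eta>) * (exp (\<beta>\<^sup>2) * (((\<integral>g. (P g)\<^sup>2 \<partial>tree_gauss) + (integral\<^sup>L tree_gauss P)\<^sup>2) / 2)) +
      (1 + 1 / \<eta>) * (exp (\<beta>\<^sup>2) * (1 + \<beta>\<^sup>2) *
        (((\<integral>g. (Q g)\<^sup>2 \<partial>tree_gauss) + (integral\<^sup>L tree_gauss Q)\<^sup>2) / 2))"
proof -
  define F where "F = (\<lambda>\<eta> g. (1 + \<eta>) * ((weight (g []))\<^sup>2 * (avg P g)\<^sup>2) +
    (1 + 1 / \<eta>) * ((weight (g []))\<^sup>2 * (g [] - \<beta>)\<^sup>2 * (avg Q g)\<^sup>2))"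
  have F: "has_bochner_integral tree_gauss (F \<eta>)
      ((1 + \<eta>) * (exp (\<beta>\<^sup>2) * (((\<integral>g. (P g)\<^sup>2 \<partial>tree_gauss) + (integral\<^sup>L tree_gauss P)\<^sup>2) / 2)) +
      (1 + 1 / \<eta>) * (exp (\<beta>\<^sup>2) * (1 + \<beta>\<^sup>2) *
        (((\<integral>g. (Q g)\<^sup>2 \<partial>tree_gauss) + (integral\<^sup>L tree_gauss Q)\<^sup>2) / 2)))" for \<eta>
    unfolding F_def
    by (intro has_bochner_integral_add has_bochner_integral_mult_right
        has_bochner_integral_root_avg_sq[OF has_bochner_integral_weight_sq P]
        has_bochner_integral_root_avg_sq[OF has_bochner_integral_weight_sq_centered Q])
  have le: "(der_step P Q g)\<^sup>2 \<le> F \<eta> g" if "\<eta> > 0" for \<eta> g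
  proof -
    have "(a + b)\<^sup>2 \<le> (1 + \<eta>) * a\<^sup>2 + (1 + 1 / \<eta>) * b\<^sup>2" for a b :: real
      using power2_sum_le[of "1 / \<eta>" a b] that by simp
    note mult_left_mono[OF this[of "avg P g" "(g [] - \<beta>) * avg Q g"], of "(weight (g []))\<^sup>2"]
    also have "(weight (g []))\<^sup>2 * ((1 + \<eta>) * (avg P g)\<^sup>2 + (1 + 1 / \<eta>) * ((g [] - \<beta>) * avg Q g)\<^sup>2) = F \<eta> g"
      unfolding F_def power_mult_distrib by (simp only: distrib_left mult_ac)
    finally show ?thesis
      by (simp add: der_step_def power_mult_distrib)
  qed
  show sq: "sq_int (der_step P Q)"
    by (rule sq_int_bound[of _ "F 1"])
       (use F[of 1] le[of 1] P Q in \<open>auto simp: has_bochner_integral_iff intro!: measurable_der_step dest: sq_int_measurable\<close>)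
  show "(\<integral>g. (der_step P Q g)\<^sup>2 \<partial>tree_gauss) \<le>
      (1 + \<eta>) * (exp (\<beta>\<^sup>2) * (((\<integral>g. (P g)\<^sup>2 \<partial>tree_gauss) + (integral\<^sup>L tree_gauss P)\<^sup>2) / 2)) +
      (1 + 1 / \<eta>) * (exp (\<beta>\<^sup>2) * (1 + \<beta>\<^sup>2) *
        (((\<integral>g. (Q g)\<^sup>2 \<partial>tree_gauss) + (integral\<^sup>L tree_gauss Q)\<^sup>2) / 2))" if "\<eta> > 0"
  proof -
    have "(\<integral>g. (der_step P Q g)\<^sup>2 \<partial>tree_gauss) \<le> integral\<^sup>L tree_gauss (F \<eta>)"
      using F[of \<eta>] le[OF that] by (intro integral_mono sq_int_sq sq) (auto simp: has_bochner_integral_iff)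
    then show ?thesis
      using F[of \<eta>] by (simp add: has_bochner_integral_iff)
  qed
qed

text \<open>The \<open>Q\<close> part vanishes because \<beta> is the mean of the tilted
  Gaussian.\<close>

lemma integral_der_step:
  assumes P: "sq_int P" and Q: "sq_int Q"
  shows "integral\<^sup>L tree_gauss (der_step P Q) = integral\<^sup>L tree_gauss P"
proof -
  have "has_bochner_integral tree_gauss
      (\<lambda>g. weight (g []) * avg P g + weight (g []) * (g [] - \<beta>) * avg Q g)
      (1 * integral\<^sup>L tree_gauss P + 0 * integral\<^sup>L tree_gauss Q)"
    by (intro has_bochner_integral_add has_bochner_integral_root_avg[OF has_bochner_integral_weight_1]
        has_bochner_integral_root_avg[OF has_bochner_integral_weight_centered] sq_int_integrable P Q)
  then show ?thesis
    by (simp add: has_bochner_integral_iff der_step_def[abs_def] algebra_simps)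
qed

text \<open>The condition \<open>\<beta> < beta_c / 2\<close> enters here: squared, it reads
  \<open>2 * \<beta>\<^sup>2 < ln 2\<close>. The bound 3/2 then follows from 2 < 9/4.\<close>

lemma exp_beta_sq: "exp (\<beta>\<^sup>2) > 1" "(exp (\<beta>\<^sup>2))\<^sup>2 < 2" "exp (\<beta>\<^sup>2) < 3 / 2"
proof -
  show 1: "exp (\<beta>\<^sup>2) > 1" using beta_pos by simp
  have "\<beta>\<^sup>2 < (beta_c / 2)\<^sup>2"
    using beta_pos beta_small by (intro power_strict_mono) auto
  also have "\<dots> = ln 2 / 2"
    by (simp add: beta_c_def power_divide)
  finally have "2 * \<beta>\<^sup>2 < ln 2" by simp
  then have "exp (2 * \<beta>\<^sup>2) < 2"
    by (metis exp_less_cancel_iff exp_ln zero_less_numeral)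
  then show 2: "(exp (\<beta>\<^sup>2))\<^sup>2 < 2"
    by (simp add: exp_double)
  then have "(exp (\<beta>\<^sup>2))\<^sup>2 < (3 / 2)\<^sup>2" by (simp add: power2_eq_square)
  then show "exp (\<beta>\<^sup>2) < 3 / 2"
    by (rule power_less_imp_less_base) simp
qed

lemma cas_step_diff: "cas_step (\<lambda>g. Q g - Q' g) g = cas_step Q g - cas_step Q' g"
  by (simp add: cas_step_def avg_diff algebra_simps)

text \<open>Linearity makes the increments over one generation obey the same recursion as the
  sequences.\<close>

lemma der_step_diff:
  "der_step (\<lambda>g. P g - P' g) (\<lambda>g. Q g - Q' g) g = der_step P Q g - der_step P' Q' g"
  by (simp add: der_step_def avg_diff algebra_simps)

text \<open>The functionals \<^term>\<open>cas n\<close> and \<^term>\<open>der n\<close> also use the variable at the root,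
  which plays the role of the increment on the edge leading to the root of a subtree. The
  martingales at level \<open>n\<close> are \<^term>\<open>avg (cas n)\<close> and \<^term>\<open>avg (der n)\<close>.\<close>

primrec cas :: "nat \<Rightarrow> (bool list \<Rightarrow> real) \<Rightarrow> real"
  where "cas 0 = (\<lambda>_. 1)"
  | "cas (Suc n) = cas_step (cas n)"

primrec der :: "nat \<Rightarrow> (bool list \<Rightarrow> real) \<Rightarrow> real"
  where "der 0 = (\<lambda>_. 0)"
  | "der (Suc n) = der_step (der n) (cas n)"

section \<open>Uniform second moments\<close>

lemma cas_sq: "sq_int (cas n)" "integral\<^sup>L tree_gauss (cas n) = 1"
proof -
  have "sq_int (cas n) \<and> integral\<^sup>L tree_gauss (cas n) = 1"
    by (induction n)
       (auto simp: sq_int_const integral_cas_step cas_step_sq tree_gauss.prob_space[simplified])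
  then show "sq_int (cas n)" "integral\<^sup>L tree_gauss (cas n) = 1" by auto
qed

lemma der_sq: "sq_int (der n)" "integral\<^sup>L tree_gauss (der n) = 0"
proof -
  have "sq_int (der n) \<and> integral\<^sup>L tree_gauss (der n) = 0"
    by (induction n) (auto simp: sq_int_const integral_der_step sq_int_der_step cas_sq)
  then show "sq_int (der n)" "integral\<^sup>L tree_gauss (der n) = 0" by auto
qed

lemma measurable_cas [measurable]: "cas n \<in> borel_measurable tree_gauss"
  and measurable_der [measurable]: "der n \<in> borel_measurable tree_gauss"
  using cas_sq der_sq sq_int_measurable by auto

lemma cas_pos: "cas n g > 0"
  by (induction n arbitrary: g) (auto simp: cas_step_def avg_def add_pos_pos)

lemma avg_cas_pos: "avg (cas n) g > 0"
  by (simp add: avg_def add_pos_pos cas_pos)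

text \<open>The bound is the fixed point of
  \<open>s \<mapsto> exp (\<beta>\<^sup>2) * ((s + 1) / 2)\<close>; the initial value 1 lies below
  it.\<close>

lemma cas_second_moment:
  "(\<integral>g. (cas n g)\<^sup>2 \<partial>tree_gauss) \<le> exp (\<beta>\<^sup>2) / (2 - exp (\<beta>\<^sup>2))"
proof (induction n)
  case 0
  then show ?case
    using exp_beta_sq by (simp add: tree_gauss.prob_space[simplified] field_simps)
next
  case (Suc n)
  have "(\<integral>g. (cas (Suc n) g)\<^sup>2 \<partial>tree_gauss) =
      exp (\<beta>\<^sup>2) * (((\<integral>g. (cas n g)\<^sup>2 \<partial>tree_gauss) + 1) / 2)"
    by (simp add: cas_step_sq cas_sq)
  also have "\<dots> \<le> exp (\<beta>\<^sup>2) * ((exp (\<beta>\<^sup>2) / (2 - exp (\<beta>\<^sup>2)) + 1) / 2)"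
    using Suc by (intro mult_left_mono divide_right_mono add_right_mono) auto
  also have "\<dots> = exp (\<beta>\<^sup>2) / (2 - exp (\<beta>\<^sup>2))"
    using exp_beta_sq by (simp add: field_simps)
  finally show ?case .
qed

lemma avg_cas_second_moment:
  "(\<integral>g. (avg (cas n) g)\<^sup>2 \<partial>tree_gauss) \<le> 1 / (2 - exp (\<beta>\<^sup>2))"
proof -
  have "(\<integral>g. (avg (cas n) g)\<^sup>2 \<partial>tree_gauss) = ((\<integral>g. (cas n g)\<^sup>2 \<partial>tree_gauss) + 1) / 2"
    by (simp add: avg_sq cas_sq)
  also have "\<dots> \<le> (exp (\<beta>\<^sup>2) / (2 - exp (\<beta>\<^sup>2)) + 1) / 2"
    by (intro divide_right_mono add_right_mono cas_second_moment) simp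
  also have "\<dots> = 1 / (2 - exp (\<beta>\<^sup>2))"
    using exp_beta_sq by (simp add: field_simps)
  finally show ?thesis .
qed

lemma contraction_factor: "0 \<le> 2 / 3 * exp (\<beta>\<^sup>2)" "2 / 3 * exp (\<beta>\<^sup>2) < 1"
  using exp_beta_sq by auto

text \<open>The choice \<open>\<eta> = 1 / 3\<close> gives the factor 4/3 * 1/2 = 2/3, a contraction
  since \<open>exp (\<beta>\<^sup>2) < 3 / 2\<close>.\<close>

lemma der_step_second_moment:
  assumes "sq_int P" "sq_int Q" "integral\<^sup>L tree_gauss P = 0"
  shows "(\<integral>g. (der_step P Q g)\<^sup>2 \<partial>tree_gauss) \<le>
    2 / 3 * exp (\<beta>\<^sup>2) * (\<integral>g. (P g)\<^sup>2 \<partial>tree_gauss) +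
    2 * exp (\<beta>\<^sup>2) * (1 + \<beta>\<^sup>2) * ((\<integral>g. (Q g)\<^sup>2 \<partial>tree_gauss) + (integral\<^sup>L tree_gauss Q)\<^sup>2)"
  using der_step_sq(2)[OF assms(1,2), of "1 / 3"] assms(3) by simp

lemma der_second_moment: "\<exists>p. \<forall>n. (\<integral>g. (der n g)\<^sup>2 \<partial>tree_gauss) \<le> p"
proof -
  define K where "K = 2 * exp (\<beta>\<^sup>2) * (1 + \<beta>\<^sup>2) * (exp (\<beta>\<^sup>2) / (2 - exp (\<beta>\<^sup>2)) + 1)"
  have "(\<integral>g. (der (Suc n) g)\<^sup>2 \<partial>tree_gauss) \<le> 2 / 3 * exp (\<beta>\<^sup>2) * (\<integral>g. (der n g)\<^sup>2 \<partial>tree_gauss) + K" for n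
  proof -
    have "2 * exp (\<beta>\<^sup>2) * (1 + \<beta>\<^sup>2) * ((\<integral>g. (cas n g)\<^sup>2 \<partial>tree_gauss) + 1) \<le> K"
      unfolding K_def using cas_second_moment[of n] by (intro mult_left_mono) auto
    then show ?thesis
      using der_step_second_moment[OF der_sq(1) cas_sq(1) der_sq(2), of n n] by (simp add: cas_sq)
  qed
  from affine_recursion_bounded[of "\<lambda>n. \<integral>g. (der n g)\<^sup>2 \<partial>tree_gauss", OF this contraction_factor]
  show ?thesis by blast
qed

section \<open>Almost sure convergence of the derivative martingale\<close>

lemma der_increment_decay:
  "\<exists>h. \<forall>n. (\<integral>g. (der (Suc n) g - der n g)\<^sup>2 \<partial>tree_gauss) \<le> h * (2 / 3 * exp (\<beta>\<^sup>2)) ^ n"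
proof -
  define D where "D n = (\<lambda>g. der (Suc n) g - der n g)" for n
  define E where "E n = (\<lambda>g. cas (Suc n) g - cas n g)" for n
  define \<rho> where "\<rho> = 2 / 3 * exp (\<beta>\<^sup>2)"
  define p where "p n = (\<integral>g. (D n g)\<^sup>2 \<partial>tree_gauss)" for n
  define q where "q n = (\<integral>g. (E n g)\<^sup>2 \<partial>tree_gauss)" for n
  \<comment> \<open>Makes \<open>p n + \<Lambda> * q n\<close> contract by \<open>\<rho>\<close>:
    \<open>q\<close> alone contracts by \<open>exp (\<beta>\<^sup>2) / 2\<close>, and the gain
    \<open>\<Lambda> * exp (\<beta>\<^sup>2) / 6\<close> equals the coefficient of \<open>q\<close>
    in the recursion for \<open>p\<close>.\<close>
  define \<Lambda> where "\<Lambda> = 12 * (1 + \<beta>\<^sup>2)"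
  have D: "sq_int (D n)" "integral\<^sup>L tree_gauss (D n) = 0"
    and E: "sq_int (E n)" "integral\<^sup>L tree_gauss (E n) = 0" for n
    unfolding D_def E_def by (auto intro!: sq_int_diff der_sq cas_sq simp del: cas.simps der.simps)
       (simp_all add: Bochner_Integration.integral_diff sq_int_integrable der_sq cas_sq del: cas.simps der.simps)
  have D_Suc: "D (Suc n) = der_step (D n) (E n)" for n
    by (rule ext) (simp only: D_def E_def der.simps(2) cas.simps(2) der_step_diff)
  have E_Suc: "E (Suc n) = cas_step (E n)" for n
    by (rule ext) (simp only: E_def cas.simps(2) cas_step_diff)
  have q_Suc: "q (Suc n) = exp (\<beta>\<^sup>2) / 2 * q n" for n
    unfolding q_def E_Suc by (simp add: cas_step_sq E)
  have p_Suc: "p (Suc n) \<le> \<rho> * p n + 2 * exp (\<beta>\<^sup>2) * (1 + \<beta>\<^sup>2) * q n" for n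
    using der_step_second_moment[OF D(1) E(1) D(2), of n n] by (simp add: p_def q_def D_Suc E \<rho>_def)
  have q0: "q n \<ge> 0" for n
    unfolding q_def by (rule Bochner_Integration.integral_nonneg) simp
  have "p n + \<Lambda> * q n \<le> (p 0 + \<Lambda> * q 0) * \<rho> ^ n" for n
  proof (induction n)
    case (Suc n)
    have "p (Suc n) + \<Lambda> * q (Suc n) \<le>
        \<rho> * p n + 2 * exp (\<beta>\<^sup>2) * (1 + \<beta>\<^sup>2) * q n + \<Lambda> * (exp (\<beta>\<^sup>2) / 2 * q n)"
      using p_Suc[of n] by (simp add: q_Suc)
    also have "\<dots> = \<rho> * (p n + \<Lambda> * q n)"
      unfolding \<Lambda>_def \<rho>_def by (simp add: field_simps)
    also have "\<dots> \<le> \<rho> * ((p 0 + \<Lambda> * q 0) * \<rho> ^ n)"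
      using Suc contraction_factor by (intro mult_left_mono) (auto simp: \<rho>_def)
    finally show ?case by (simp add: mult_ac)
  qed simp
  moreover have "\<Lambda> * q n \<ge> 0" for n
    using q0[of n] by (simp add: \<Lambda>_def)
  ultimately have "p n \<le> (p 0 + \<Lambda> * q 0) * \<rho> ^ n" for n
    by (smt (verit))
  then show ?thesis
    unfolding p_def[of "_ :: nat"] \<rho>_def D_def by blast
qed

text \<open>The increments decay geometrically in L2, hence in L1, so the sum of their absolute
  values has finite mean and is almost surely finite.\<close>

lemma AE_convergent_avg_der: "AE g in tree_gauss. convergent (\<lambda>n. avg (der n) g)"
proof -
  define \<rho> where "\<rho> = 2 / 3 * exp (\<beta>\<^sup>2)"
  define \<theta> where "\<theta> = sqrt \<rho>"
  have \<theta>: "0 < \<theta>" "\<theta> < 1" "\<theta>\<^sup>2 = \<rho>"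
    using contraction_factor unfolding \<theta>_def \<rho>_def by auto
  obtain h where h: "\<And>n. (\<integral>g. (der (Suc n) g - der n g)\<^sup>2 \<partial>tree_gauss) \<le> h * \<rho> ^ n"
    using der_increment_decay unfolding \<rho>_def by blast
  define D where "D n = avg (\<lambda>g. der (Suc n) g - der n g)" for n
  have sq: "sq_int (\<lambda>g. der (Suc n) g - der n g)" for n
    by (intro sq_int_diff der_sq)
  have D: "sq_int (D n)" for n
    unfolding D_def by (rule avg_sq[OF sq])
  have D2: "(\<integral>g. (D n g)\<^sup>2 \<partial>tree_gauss) \<le> h * \<rho> ^ n" for n
  proof -
    have "integral\<^sup>L tree_gauss (\<lambda>g. der (Suc n) g - der n g) = 0"
      by (subst Bochner_Integration.integral_diff)
         (simp_all add: sq_int_integrable der_sq del: der.simps)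
    moreover have nn: "0 \<le> (\<integral>g. (der (Suc n) g - der n g)\<^sup>2 \<partial>tree_gauss)"
      by (rule Bochner_Integration.integral_nonneg) simp
    moreover have "(\<integral>g. (D n g)\<^sup>2 \<partial>tree_gauss) = ((\<integral>g. (der (Suc n) g - der n g)\<^sup>2 \<partial>tree_gauss)
        + (integral\<^sup>L tree_gauss (\<lambda>g. der (Suc n) g - der n g))\<^sup>2) / 2"
      unfolding D_def by (rule avg_sq(3)[OF sq])
    ultimately have "(\<integral>g. (D n g)\<^sup>2 \<partial>tree_gauss) = (\<integral>g. (der (Suc n) g - der n g)\<^sup>2 \<partial>tree_gauss) / 2"
      by (simp del: der.simps)
    with nn have "(\<integral>g. (D n g)\<^sup>2 \<partial>tree_gauss) \<le> (\<integral>g. (der (Suc n) g - der n g)\<^sup>2 \<partial>tree_gauss)"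
      by linarith
    then show ?thesis
      using h[of n] by linarith
  qed
  have int: "(\<integral>g. \<bar>D n g\<bar> \<partial>tree_gauss) \<le> (h + 1) * \<theta> ^ n" for n
  proof -
    \<comment> \<open>Splitting at scale \<open>\<theta> ^ n\<close> makes both terms of order
      \<open>\<theta> ^ n\<close> after integration, as
      \<open>\<theta>\<^sup>2 = \<rho>\<close>.\<close>
    have "\<bar>x\<bar> \<le> x\<^sup>2 / \<theta> ^ n + \<theta> ^ n" for x
    proof -
      have "0 \<le> \<bar>x\<bar> * \<theta> ^ n"
        using \<theta>(1) by simp
      moreover have "2 * (\<bar>x\<bar> * \<theta> ^ n) \<le> x\<^sup>2 + \<theta> ^ n * \<theta> ^ n"
        using sum_squares_bound[of "\<bar>x\<bar>" "\<theta> ^ n"] by (simp add: power2_eq_square)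
      ultimately have "\<bar>x\<bar> * \<theta> ^ n \<le> x\<^sup>2 + \<theta> ^ n * \<theta> ^ n"
        by linarith
      then have "\<bar>x\<bar> \<le> (x\<^sup>2 + \<theta> ^ n * \<theta> ^ n) / \<theta> ^ n"
        using \<theta>(1) by (simp add: pos_le_divide_eq)
      then show ?thesis
        using \<theta>(1) by (simp add: add_divide_distrib)
    qed
    then have "(\<integral>g. \<bar>D n g\<bar> \<partial>tree_gauss) \<le> (\<integral>g. (D n g)\<^sup>2 / \<theta> ^ n + \<theta> ^ n \<partial>tree_gauss)"
      by (intro integral_mono Bochner_Integration.integrable_add integrable_divide_zero integrable_abs
          sq_int_integrable[OF D] sq_int_sq[OF D]) auto
    also have "\<dots> = (\<integral>g. (D n g)\<^sup>2 \<partial>tree_gauss) / \<theta> ^ n + \<theta> ^ n"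
      by (subst Bochner_Integration.integral_add)
         (auto intro!: sq_int_sq D simp: tree_gauss.prob_space[simplified])
    also have "\<dots> \<le> h * \<rho> ^ n / \<theta> ^ n + \<theta> ^ n"
      using D2[of n] \<theta>(1) by (intro add_right_mono divide_right_mono) auto
    also have "\<dots> = (h + 1) * \<theta> ^ n"
    proof -
      have "\<rho> ^ n = \<theta> ^ n * \<theta> ^ n"
        by (simp only: \<theta>(3)[symmetric] power2_eq_square power_mult_distrib)
      then show ?thesis
        using \<theta>(1) by (simp add: distrib_right)
    qed
    finally show ?thesis .
  qed
  have [measurable]: "D n \<in> borel_measurable tree_gauss" for n
    by (rule sq_int_measurable[OF D])
  have "(\<integral>\<^sup>+g. (\<Sum>n. ennreal \<bar>D n g\<bar>) \<partial>tree_gauss) = (\<Sum>n. \<integral>\<^sup>+g. ennreal \<bar>D n g\<bar> \<partial>tree_gauss)"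
    by (rule nn_integral_suminf) measurable
  also have "\<dots> = (\<Sum>n. ennreal (\<integral>g. \<bar>D n g\<bar> \<partial>tree_gauss))"
    by (intro suminf_cong nn_integral_eq_integral integrable_abs sq_int_integrable[OF D]) auto
  also have "\<dots> \<le> (\<Sum>n. ennreal ((h + 1) * \<theta> ^ n))"
    by (intro suminf_le ennreal_leI int) auto
  also have "\<dots> < \<infinity>"
  proof -
    \<comment> \<open>The sign of \<open>h\<close> is not given; the bound at generation 0 shows
      that \<open>h + 1\<close> is nonnegative.\<close>
    have "0 \<le> (\<integral>g. \<bar>D 0 g\<bar> \<partial>tree_gauss)"
      by (rule Bochner_Integration.integral_nonneg) simp
    from order_trans[OF this int[of 0]] have "h + 1 \<ge> 0" by simp
    moreover have "summable (\<lambda>n. (h + 1) * \<theta> ^ n)"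
      using \<theta> by (intro summable_mult summable_geometric) auto
    ultimately show ?thesis
      using \<theta>(1) by (subst suminf_ennreal2) auto
  qed
  finally have "AE g in tree_gauss. (\<Sum>n. ennreal \<bar>D n g\<bar>) \<noteq> \<infinity>"
    by (intro nn_integral_PInf_AE) auto
  then show ?thesis
  proof eventually_elim
    case (elim g)
    have "summable (\<lambda>n. \<bar>D n g\<bar>)"
      by (rule summable_suminf_not_top) (use elim in auto)
    then have "summable (\<lambda>n. D n g)"
      by (rule summable_rabs_cancel)
    then have "convergent (\<lambda>n. \<Sum>i<n. D i g)"
      by (simp add: summable_iff_convergent)
    moreover have "(\<Sum>i<n. D i g) = avg (der n) g - avg (der 0) g" for n
      unfolding D_def avg_diff by (rule sum_lessThan_telescope)
    moreover have "avg (der 0) g = 0"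
      by (simp add: avg_def)
    ultimately show ?case by simp
  qed
qed

section \<open>The dominating functional\<close>

text \<open>The value of \<open>weight x * exp (- \<beta> * (x - \<beta>))\<close>, which is the
  same for all \<open>x\<close>.\<close>

definition growth :: real where "growth = exp (\<beta>\<^sup>2 / 2)"

lemma growth: "growth > 1" "growth\<^sup>2 = exp (\<beta>\<^sup>2)" "growth < 2"
proof -
  show g: "growth > 1" "growth\<^sup>2 = exp (\<beta>\<^sup>2)"
    using beta_pos by (simp_all add: growth_def exp_double[symmetric])
  have "growth\<^sup>2 < 2\<^sup>2" using g exp_beta_sq by simp
  then show "growth < 2" by (rule power_less_imp_less_base) simp
qed

text \<open>Up to the factor \<open>exp 1 * \<beta>\<close>, this is the supremum over \<open>y\<close> of
  \<open>- exp (\<beta> * y) * (der n g + y * cas n g)\<close>.\<close>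

definition xi :: "nat \<Rightarrow> (bool list \<Rightarrow> real) \<Rightarrow> real"
  where "xi n g = cas n g * exp (- \<beta> * (der n g / cas n g))"

lemma xi_pos: "xi n g > 0"
  by (simp add: xi_def cas_pos)

lemma measurable_xi [measurable]: "xi n \<in> borel_measurable tree_gauss"
  unfolding xi_def[abs_def] by measurable

text \<open>The root increment shifts the quotient of \<open>der\<close> and \<open>cas\<close> by
  \<open>g [] - \<beta>\<close>, and the resulting exponential cancels the weight up to a
  constant.\<close>

lemma xi_Suc: "xi (Suc n) g = growth * avg (cas n) g * exp (- \<beta> * (avg (der n) g / avg (cas n) g))"
proof -
  let ?W = "avg (cas n) g" and ?Z = "avg (der n) g"
  have "der (Suc n) g / cas (Suc n) g = ?Z / ?W + (g [] - \<beta>)"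
    using avg_cas_pos[of n g] weight_pos[of "g []"]
    by (simp add: der_step_def cas_step_def add_divide_distrib less_imp_neq[symmetric])
  then have "xi (Suc n) g = weight (g []) * ?W * exp (- \<beta> * (?Z / ?W + (g [] - \<beta>)))"
    by (simp add: xi_def cas_step_def)
  also have "\<dots> = ?W * exp ((\<beta> * g [] - \<beta>\<^sup>2 / 2) + - \<beta> * (?Z / ?W + (g [] - \<beta>)))"
    unfolding weight_def exp_add by simp
  also have "(\<beta> * g [] - \<beta>\<^sup>2 / 2) + - \<beta> * (?Z / ?W + (g [] - \<beta>)) = \<beta>\<^sup>2 / 2 + - \<beta> * (?Z / ?W)"
    by (simp add: power2_eq_square field_simps)
  finally show ?thesis
    unfolding exp_add growth_def by simp
qed

text \<open>Subadditivity of the perspective of \<open>exp\<close>, applied to the values of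
  \<open>cas\<close> and \<open>der\<close> on the two subtrees.\<close>

lemma xi_Suc_le: "xi (Suc n) g \<le> growth / 2 * (xi n (subtree False g) + xi n (subtree True g))"
proof -
  let ?a = "\<lambda>b. cas n (subtree b g)" and ?b = "\<lambda>b. der n (subtree b g)"
  have "avg (der n) g / avg (cas n) g = (?b False + ?b True) / (?a False + ?a True)"
  proof -
    have "x / 2 / (y / 2) = x / y" for x y :: real by simp
    then show ?thesis unfolding avg_def .
  qed
  then have "xi (Suc n) g = growth / 2 * ((?a False + ?a True) *
      exp (- \<beta> * ((?b False + ?b True) / (?a False + ?a True))))"
    unfolding xi_Suc by (simp add: avg_def)
  also have "\<dots> \<le> growth / 2 * (xi n (subtree False g) + xi n (subtree True g))"
    unfolding xi_def using growth(1)
    by (intro mult_left_mono exp_perspective_le cas_pos) auto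
  finally show ?thesis .
qed

text \<open>Deterministic but not uniform in \<open>n\<close>; it serves to make all moments of
  \<open>xi n\<close>, also exponential ones, finite.\<close>

lemma xi_le: "xi n g \<le> growth ^ n"
proof (induction n arbitrary: g)
  case (Suc n)
  have "xi (Suc n) g \<le> growth / 2 * (xi n (subtree False g) + xi n (subtree True g))"
    by (rule xi_Suc_le)
  also have "\<dots> \<le> growth / 2 * (growth ^ n + growth ^ n)"
    using growth(1) by (intro mult_left_mono add_mono Suc) auto
  finally show ?case by simp
qed (simp add: xi_def)

text \<open>The tangent bound \<open>s + 1 \<le> exp s\<close> at
  \<open>s = - \<beta> * y - 1\<close>; the shift by 1 produces the factor
  \<open>exp 1\<close>.\<close>

lemma der_ge: "der n g \<ge> - xi n g / (exp 1 * \<beta>)"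
proof -
  define y where "y = der n g / cas n g"
  have "- \<beta> * y \<le> exp (- \<beta> * y - 1)"
    using exp_ge_add_one_self[of "- \<beta> * y - 1"] by simp
  also have "\<dots> = exp (- \<beta> * y) / exp 1"
    by (rule exp_diff)
  finally have "- y \<le> exp (- \<beta> * y) / (exp 1 * \<beta>)"
    using beta_pos by (simp add: field_simps)
  from mult_left_mono[OF this, of "cas n g"]
  have "- (cas n g * y) \<le> xi n g / (exp 1 * \<beta>)"
    using cas_pos[of n g] by (simp add: xi_def y_def)
  moreover have "cas n g * y = der n g"
    using cas_pos[of n g] by (simp add: y_def)
  ultimately show ?thesis by simp
qed

section \<open>Integrability and the uniform bound on the mean\<close>

lemma integrable_xi_bounded:
  assumes "f \<in> borel_measurable borel" "\<And>x. 0 < x \<Longrightarrow> x \<le> growth ^ n \<Longrightarrow> \<bar>f x\<bar> \<le> (B :: real)"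
  shows "integrable tree_gauss (\<lambda>g. f (xi n g))"
proof (rule tree_gauss.integrable_const_bound[of _ B])
  show "(\<lambda>g. f (xi n g)) \<in> borel_measurable tree_gauss"
    by (rule measurable_compose[OF measurable_xi assms(1)])
qed (auto intro!: assms(2) xi_pos xi_le)

lemma sq_int_xi: "sq_int (xi n)"
  unfolding sq_int_def
  by (auto intro!: integrable_xi_bounded[of "\<lambda>x. x\<^sup>2" n "(growth ^ n)\<^sup>2"] power_mono)

lemma integrable_exp_xi: "t \<ge> 0 \<Longrightarrow> integrable tree_gauss (\<lambda>g. exp (t * xi n g))"
  by (rule integrable_xi_bounded[of "\<lambda>x. exp (t * x)" n "exp (t * growth ^ n)"])
     (auto intro: mult_left_mono)

text \<open>Paley-Zygmund, with mean 1 and second moment at most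
  \<open>1 / (2 - exp (\<beta>\<^sup>2))\<close>. As \<open>w\<close> tends to 0 the bound tends to
  \<open>exp (\<beta>\<^sup>2) - 1\<close>.\<close>

lemma prob_avg_cas_small:
  assumes w: "0 < w" "w < 1"
  shows "measure tree_gauss {g. avg (cas n) g < w} \<le> 1 - (1 - w)\<^sup>2 * (2 - exp (\<beta>\<^sup>2))"
proof -
  let ?W = "avg (cas n)" and ?S = "{g. w \<le> avg (cas n) g}"
  note W = avg_sq[OF cas_sq(1)[of n]]
  have S [measurable]: "?S \<in> sets tree_gauss"
    using borel_measurable_le[of "\<lambda>_. w" tree_gauss ?W] by simp
  have int: "integrable tree_gauss (\<lambda>g. ?W g * indicator ?S g)"
    using integrable_real_mult_indicator[OF S sq_int_integrable[OF W(1)]] .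
  have "1 = (\<integral>g. ?W g \<partial>tree_gauss)"
    by (simp add: W cas_sq)
  also have "\<dots> \<le> (\<integral>g. w + ?W g * indicator ?S g \<partial>tree_gauss)"
    using w int by (intro integral_mono sq_int_integrable[OF W(1)] Bochner_Integration.integrable_add)
      (auto simp: indicator_def)
  also have "\<dots> = w + (\<integral>g. ?W g * indicator ?S g \<partial>tree_gauss)"
    using int by (simp add: tree_gauss.prob_space[simplified])
  finally have "1 - w \<le> (\<integral>g. ?W g * indicator ?S g \<partial>tree_gauss)" by simp
  then have "(1 - w)\<^sup>2 \<le> (\<integral>g. ?W g * indicator ?S g \<partial>tree_gauss)\<^sup>2"
    using w by (intro power_mono) auto
  also have "\<dots> \<le> (\<integral>g. (?W g)\<^sup>2 \<partial>tree_gauss) * measure tree_gauss ?S"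
    by (rule Cauchy_Schwarz_event[OF W(1) S])
  also have "(\<integral>g. (?W g)\<^sup>2 \<partial>tree_gauss) * measure tree_gauss ?S \<le> 1 / (2 - exp (\<beta>\<^sup>2)) * measure tree_gauss ?S"
    by (intro mult_right_mono avg_cas_second_moment) simp
  finally have "(1 - w)\<^sup>2 * (2 - exp (\<beta>\<^sup>2)) \<le> measure tree_gauss ?S"
    using exp_beta_sq by (simp add: field_simps)
  moreover have "measure tree_gauss {g. ?W g < w} = 1 - measure tree_gauss ?S"
    using tree_gauss.prob_compl[OF S] by (simp add: set_diff_eq not_le)
  ultimately show ?thesis by simp
qed

text \<open>Chebyshev's inequality; a large \<open>z\<close> makes this bound arbitrarily small,
  uniformly in \<open>n\<close>.\<close>

lemma prob_avg_der_small:
  assumes p: "\<And>n. (\<integral>g. (der n g)\<^sup>2 \<partial>tree_gauss) \<le> p" and z: "z > 0"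
  shows "measure tree_gauss {g. avg (der n) g < - z} \<le> p / z\<^sup>2"
proof -
  note Z = avg_sq[OF der_sq(1)[of n]]
  have "(\<integral>g. (avg (der n) g)\<^sup>2 \<partial>tree_gauss) = (\<integral>g. (der n g)\<^sup>2 \<partial>tree_gauss) / 2"
    by (simp add: Z der_sq)
  moreover have "0 \<le> (\<integral>g. (der n g)\<^sup>2 \<partial>tree_gauss)"
    by (rule Bochner_Integration.integral_nonneg) simp
  ultimately have Z2: "(\<integral>g. (avg (der n) g)\<^sup>2 \<partial>tree_gauss) \<le> p"
    using p[of n] by linarith
  have [measurable]: "avg (der n) \<in> borel_measurable tree_gauss" by simp
  have m: "{g. (avg (der n) g)\<^sup>2 \<ge> z\<^sup>2} \<in> sets tree_gauss"
    using borel_measurable_le[of "\<lambda>_. z\<^sup>2" tree_gauss "\<lambda>g. (avg (der n) g)\<^sup>2"] by simp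
  have "measure tree_gauss {g. avg (der n) g < - z} \<le> measure tree_gauss {g. (avg (der n) g)\<^sup>2 \<ge> z\<^sup>2}"
  proof (intro tree_gauss.finite_measure_mono m subsetI, simp)
    fix g assume "avg (der n) g < - z"
    then have "z\<^sup>2 \<le> (- avg (der n) g)\<^sup>2" using z by (intro power_mono) auto
    then show "z\<^sup>2 \<le> (avg (der n) g)\<^sup>2" by simp
  qed
  also have "\<dots> \<le> (\<integral>g. (avg (der n) g)\<^sup>2 \<partial>tree_gauss) / z\<^sup>2"
    using integral_Markov_inequality_measure[of tree_gauss "\<lambda>g. (avg (der n) g)\<^sup>2" "{}" "z\<^sup>2"] z
      sq_int_sq[OF Z(1)] by simp
  also have "\<dots> \<le> p / z\<^sup>2"
    by (intro divide_right_mono Z2) simp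
  finally show ?thesis .
qed

text \<open>Off the bad event the exponential in \<open>xi_Suc\<close> is at most
  \<open>exp (\<beta> * z / w)\<close>, and \<open>avg (cas n)\<close> has mean 1. On it,
  Cauchy-Schwarz puts only the factor \<open>\<epsilon>\<close> before the second moment.\<close>

lemma xi_mean_le:
  assumes w: "w > 0" and z: "z > 0"
    and \<epsilon>: "measure tree_gauss {g. avg (cas n) g < w} + measure tree_gauss {g. avg (der n) g < - z} \<le> \<epsilon>"
  shows "integral\<^sup>L tree_gauss (xi (Suc n)) \<le>
    growth * exp (\<beta> * z / w) + sqrt (\<epsilon> * (\<integral>g. (xi (Suc n) g)\<^sup>2 \<partial>tree_gauss))"
proof -
  let ?W = "avg (cas n)" and ?Z = "avg (der n)"
  let ?X = "xi (Suc n)"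
  let ?S = "{g. ?W g < w} \<union> {g. ?Z g < - z}"
  note W = avg_sq[OF cas_sq(1)[of n]] and Z = avg_sq[OF der_sq(1)[of n]]
  have S1: "{g. ?W g < w} \<in> sets tree_gauss" and S2: "{g. ?Z g < - z} \<in> sets tree_gauss"
    using borel_measurable_less[of ?W tree_gauss "\<lambda>_. w"] borel_measurable_less[of ?Z tree_gauss "\<lambda>_. - z"]
    by simp_all
  then have S [measurable]: "?S \<in> sets tree_gauss" by simp
  have int: "integrable tree_gauss (\<lambda>g. ?X g * indicator ?S g)"
    using integrable_real_mult_indicator[OF S sq_int_integrable[OF sq_int_xi]] .
  have le: "?X g \<le> growth * exp (\<beta> * z / w) * ?W g + ?X g * indicator ?S g" for g
  proof (cases "g \<in> ?S")
    case True
    then show ?thesis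
      using growth(1) avg_cas_pos[of n g] by simp
  next
    case False
    then have g: "w \<le> ?W g" "- z \<le> ?Z g" by auto
    have "- ?Z g / ?W g \<le> z / w"
      using g w z by (intro frac_le) auto
    from mult_left_mono[OF this, of \<beta>] have "exp (- \<beta> * (?Z g / ?W g)) \<le> exp (\<beta> * z / w)"
      using beta_pos by simp
    from mult_left_mono[OF this, of "growth * ?W g"] show ?thesis
      using False growth(1) avg_cas_pos[of n g] unfolding xi_Suc by (simp add: mult_ac)
  qed
  have "(\<integral>g. ?X g \<partial>tree_gauss) \<le> (\<integral>g. growth * exp (\<beta> * z / w) * ?W g + ?X g * indicator ?S g \<partial>tree_gauss)"
    using int by (intro integral_mono le Bochner_Integration.integrable_add integrable_mult_right
      sq_int_integrable[OF sq_int_xi] sq_int_integrable[OF W(1)])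
  also have "\<dots> = growth * exp (\<beta> * z / w) + (\<integral>g. ?X g * indicator ?S g \<partial>tree_gauss)"
    using int sq_int_integrable[OF W(1)] by (simp add: W(2) cas_sq)
  also have "(\<integral>g. ?X g * indicator ?S g \<partial>tree_gauss) \<le> sqrt (\<epsilon> * (\<integral>g. (?X g)\<^sup>2 \<partial>tree_gauss))"
  proof (rule real_le_rsqrt)
    have "(\<integral>g. ?X g * indicator ?S g \<partial>tree_gauss)\<^sup>2 \<le>
        (\<integral>g. (?X g)\<^sup>2 \<partial>tree_gauss) * measure tree_gauss ?S"
      by (rule Cauchy_Schwarz_event[OF sq_int_xi S])
    also have "(\<integral>g. (?X g)\<^sup>2 \<partial>tree_gauss) * measure tree_gauss ?S \<le> (\<integral>g. (?X g)\<^sup>2 \<partial>tree_gauss) * \<epsilon>"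
      using order_trans[OF measure_Un_le[OF S1 S2] \<epsilon>]
      by (intro mult_left_mono) auto
    finally show "(\<integral>g. ?X g * indicator ?S g \<partial>tree_gauss)\<^sup>2 \<le> \<epsilon> * (\<integral>g. (?X g)\<^sup>2 \<partial>tree_gauss)"
      by (simp add: mult_ac)
  qed
  finally show ?thesis by simp
qed

lemma xi_second_moment_Suc:
  "(\<integral>g. (xi (Suc n) g)\<^sup>2 \<partial>tree_gauss) \<le>
    exp (\<beta>\<^sup>2) / 2 * ((\<integral>g. (xi n g)\<^sup>2 \<partial>tree_gauss) + (integral\<^sup>L tree_gauss (xi n))\<^sup>2)"
proof -
  have "(xi (Suc n) g)\<^sup>2 \<le> exp (\<beta>\<^sup>2) * (avg (xi n) g)\<^sup>2" for g
  proof -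
    have "xi (Suc n) g \<le> growth * avg (xi n) g"
      using xi_Suc_le[of n g] by (simp add: avg_def)
    then have "(xi (Suc n) g)\<^sup>2 \<le> (growth * avg (xi n) g)\<^sup>2"
      by (intro power_mono) (auto intro: less_imp_le xi_pos)
    then show ?thesis by (simp add: power_mult_distrib growth)
  qed
  then have "(\<integral>g. (xi (Suc n) g)\<^sup>2 \<partial>tree_gauss) \<le> (\<integral>g. exp (\<beta>\<^sup>2) * (avg (xi n) g)\<^sup>2 \<partial>tree_gauss)"
    by (intro integral_mono integrable_mult_right sq_int_sq avg_sq sq_int_xi)
  also have "\<dots> = exp (\<beta>\<^sup>2) * (\<integral>g. (avg (xi n) g)\<^sup>2 \<partial>tree_gauss)"
    by simp
  finally show ?thesis by (simp add: avg_sq sq_int_xi)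
qed

text \<open>In \<open>xi_mean_le\<close>, as \<open>w \<rightarrow> 0\<close> and \<open>z \<rightarrow> \<infinity>\<close> the bad event has probability at most about
  \<open>exp (\<beta>\<^sup>2) - 1\<close>, and the second moment contracts by \<open>exp (\<beta>\<^sup>2) / 2 * (1 + (exp (\<beta>\<^sup>2) - 1))\<close>,
  which is below one exactly when \<open>\<beta> < beta_c / 2\<close>.\<close>

lemma xi_mean_bounded: "\<exists>M. \<forall>n. integral\<^sup>L tree_gauss (xi n) \<le> M"
proof -
  let ?e = "exp (\<beta>\<^sup>2)"
  \<comment> \<open>\<open>\<kappa>\<close> is critical:
    \<open>exp (\<beta>\<^sup>2) / 2 * (1 + \<kappa>) = 1\<close>. The gap from
    \<open>exp (\<beta>\<^sup>2) - 1\<close> up to \<open>\<kappa>\<close> is cut into four pieces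
    \<open>\<zeta>\<close>: two for the bad event, one for Young's inequality through
    \<open>\<theta>\<close>, one as slack.\<close>
  define \<kappa> where "\<kappa> = 2 / ?e - 1"
  define \<zeta> where "\<zeta> = (\<kappa> - (?e - 1)) / 4"
  define \<epsilon> where "\<epsilon> = ?e - 1 + 2 * \<zeta>"
  define \<theta> where "\<theta> = \<zeta> / \<epsilon>"
  have e: "1 < ?e" "?e * ?e < 2" "?e < 3 / 2"
    using exp_beta_sq by (auto simp: power2_eq_square)
  have "?e < 2 / ?e" using e by (simp add: field_simps)
  then have \<zeta>: "\<zeta> > 0" by (simp add: \<zeta>_def \<kappa>_def)
  have "2 / ?e < 2" using e by (simp add: field_simps)
  then have "\<zeta> < 1" using diff_strict_mono[OF _ e(1), of "2 / ?e" 2] by (simp add: \<zeta>_def \<kappa>_def)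
  have \<epsilon>: "\<epsilon> > 0" unfolding \<epsilon>_def using e(1) \<zeta> by linarith
  have \<theta>: "\<theta> > 0" using \<zeta> \<epsilon> by (simp add: \<theta>_def)
  have \<kappa>: "\<kappa> = \<epsilon> + 2 * \<zeta>" by (simp add: \<epsilon>_def \<zeta>_def field_simps)
  have \<theta>\<epsilon>: "(1 + \<theta>) * \<epsilon> = \<epsilon> + \<zeta>" using \<epsilon> by (simp add: \<theta>_def field_simps)
  obtain p where p: "\<And>n. (\<integral>g. (der n g)\<^sup>2 \<partial>tree_gauss) \<le> p"
    using der_second_moment by blast
  \<comment> \<open>Beyond \<open>exp (\<beta>\<^sup>2) - 1\<close>, the levels \<open>w\<close> and
    \<open>z\<close> cost at most \<open>\<zeta>\<close> each; \<open>\<bar>p\<bar> + 1\<close>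
    keeps \<open>z\<close> positive whatever the sign of \<open>p\<close>.\<close>
  define w where "w = \<zeta> / 2"
  define z where "z = sqrt ((\<bar>p\<bar> + 1) / \<zeta>)"
  have w: "0 < w" "w < 1" using \<zeta> \<open>\<zeta> < 1\<close> by (auto simp: w_def)
  have z: "z > 0" using \<zeta> by (simp add: z_def)
  have prob: "measure tree_gauss {g. avg (cas n) g < w} + measure tree_gauss {g. avg (der n) g < - z} \<le> \<epsilon>" for n
  proof -
    have "1 - (1 - w)\<^sup>2 * (2 - ?e) \<le> ?e - 1 + \<zeta>"
    proof -
      have "(1 - 2 * w) * (2 - ?e) \<le> (1 - w)\<^sup>2 * (2 - ?e)"
        using e by (intro mult_right_mono) (auto simp: power2_eq_square algebra_simps)
      moreover have "w * (2 - ?e) \<le> w * 1"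
        using e w by (intro mult_left_mono) auto
      ultimately show ?thesis by (simp add: w_def algebra_simps)
    qed
    moreover have "p / z\<^sup>2 \<le> \<zeta>"
    proof -
      have "z\<^sup>2 = (\<bar>p\<bar> + 1) / \<zeta>" using \<zeta> by (simp add: z_def)
      then have "p / z\<^sup>2 = p * \<zeta> / (\<bar>p\<bar> + 1)" by simp
      also have "\<dots> \<le> (\<bar>p\<bar> + 1) * \<zeta> / (\<bar>p\<bar> + 1)"
        using \<zeta> by (intro divide_right_mono mult_right_mono) auto
      finally show ?thesis by simp
    qed
    ultimately show ?thesis
      using prob_avg_cas_small[OF w, of n] prob_avg_der_small[OF p z, of n] by (simp add: \<epsilon>_def)
  qed
  define a where "a = growth * exp (\<beta> * z / w)"
  have a: "a \<ge> 1"
  proof -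
    have "1 * 1 \<le> a"
      unfolding a_def using growth(1) beta_pos w z by (intro mult_mono) auto
    then show ?thesis by simp
  qed
  define s where "s n = (\<integral>g. (xi n g)\<^sup>2 \<partial>tree_gauss)" for n
  have s: "s n \<ge> 0" for n
    unfolding s_def by (rule Bochner_Integration.integral_nonneg) simp
  \<comment> \<open>\<open>xi_mean_le\<close> starts at generation 1; generation 0 has mean 1 and is
    covered by \<open>a \<ge> 1\<close>.\<close>
  have mean: "integral\<^sup>L tree_gauss (xi n) \<le> a + sqrt (\<epsilon> * s n)" for n
  proof (cases n)
    case 0
    have "integral\<^sup>L tree_gauss (xi 0) = 1"
      by (simp add: xi_def[abs_def] tree_gauss.prob_space[simplified])
    moreover have "0 \<le> sqrt (\<epsilon> * s 0)" using \<epsilon> s[of 0] by simp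
    ultimately show ?thesis using a unfolding 0 by linarith
  next
    case (Suc k)
    show ?thesis
      unfolding Suc s_def a_def by (rule xi_mean_le[OF w(1) z prob])
  qed
  have mean0: "0 \<le> integral\<^sup>L tree_gauss (xi n)" for n
    by (rule Bochner_Integration.integral_nonneg) (auto intro: less_imp_le xi_pos)
  define \<rho> where "\<rho> = ?e / 2 * (1 + (\<epsilon> + \<zeta>))"
  define K where "K = ?e / 2 * ((1 + 1 / \<theta>) * a\<^sup>2)"
  have step: "s (Suc n) \<le> \<rho> * s n + K" for n
  proof -
    have "(integral\<^sup>L tree_gauss (xi n))\<^sup>2 \<le> (a + sqrt (\<epsilon> * s n))\<^sup>2"
      using mean mean0 by (intro power_mono)
    also have "\<dots> \<le> (1 + 1 / \<theta>) * a\<^sup>2 + (1 + \<theta>) * (sqrt (\<epsilon> * s n))\<^sup>2"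
      by (rule power2_sum_le[OF \<theta>])
    also have "(1 + \<theta>) * (sqrt (\<epsilon> * s n))\<^sup>2 = (\<epsilon> + \<zeta>) * s n"
      using \<epsilon> s[of n] \<theta>\<epsilon> by (simp add: mult.assoc[symmetric])
    finally have "?e / 2 * (s n + (integral\<^sup>L tree_gauss (xi n))\<^sup>2) \<le>
        ?e / 2 * (s n + ((1 + 1 / \<theta>) * a\<^sup>2 + (\<epsilon> + \<zeta>) * s n))"
      by (intro mult_left_mono add_left_mono) auto
    also have "\<dots> = \<rho> * s n + K"
      by (simp add: \<rho>_def K_def algebra_simps)
    finally show ?thesis
      using xi_second_moment_Suc[of n] by (simp add: s_def)
  qed
  have \<rho>: "0 \<le> \<rho>" "\<rho> < 1"
  proof -
    show "0 \<le> \<rho>" using \<epsilon> \<zeta> by (simp add: \<rho>_def)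
    have "?e / 2 * (1 + (\<epsilon> + \<zeta>)) < ?e / 2 * (1 + \<kappa>)"
      using \<zeta> by (intro mult_strict_left_mono) (auto simp: \<kappa>)
    also have "\<dots> = 1" by (simp add: \<kappa>_def)
    finally show "\<rho> < 1" by (simp add: \<rho>_def)
  qed
  let ?s = "max (s 0) (K / (1 - \<rho>))"
  have "integral\<^sup>L tree_gauss (xi n) \<le> a + sqrt (\<epsilon> * ?s)" for n
  proof -
    have "\<epsilon> * s n \<le> \<epsilon> * ?s"
      using affine_recursion_bounded[of s, OF step \<rho>, of n] \<epsilon> by (intro mult_left_mono) auto
    then have "sqrt (\<epsilon> * s n) \<le> sqrt (\<epsilon> * ?s)" by (rule real_sqrt_le_mono)
    then show ?thesis using mean[of n] by linarith
  qed
  then show ?thesis by blast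
qed

section \<open>Laplace transform and tail\<close>

definition laplace :: "nat \<Rightarrow> real \<Rightarrow> real"
  where "laplace n t = (\<integral>g. exp (t * xi n g) \<partial>tree_gauss)"

lemma has_bochner_integral_exp_pair:
  assumes "t \<ge> 0"
  shows "has_bochner_integral tree_gauss
    (\<lambda>g. exp (t * (xi n (subtree False g) + xi n (subtree True g)))) ((laplace n t)\<^sup>2)"
  using has_bochner_integral_branch[of "\<lambda>_. 1", OF _ integrable_exp_xi[OF assms] integrable_exp_xi[OF assms], of n n]
  by (simp add: laplace_def distrib_left exp_add power2_eq_square gauss.prob_space[simplified])

text \<open>Independence of the two subtrees turns the domination \<open>xi_Suc_le\<close> into a
  square.\<close>

lemma laplace_Suc:
  assumes "t \<ge> 0"
  shows "laplace (Suc n) t \<le> (laplace n (growth / 2 * t))\<^sup>2"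
proof -
  let ?f = "\<lambda>g. exp (growth / 2 * t * (xi n (subtree False g) + xi n (subtree True g)))"
  have *: "has_bochner_integral tree_gauss ?f ((laplace n (growth / 2 * t))\<^sup>2)"
    using growth(1) assms by (intro has_bochner_integral_exp_pair) simp
  have "laplace (Suc n) t \<le> integral\<^sup>L tree_gauss ?f"
    unfolding laplace_def
  proof (intro integral_mono integrable_exp_xi assms)
    show "integrable tree_gauss ?f" using * by (simp add: has_bochner_integral_iff)
    show "exp (t * xi (Suc n) g) \<le> ?f g" for g
      using mult_left_mono[OF xi_Suc_le assms, of n g] by (simp add: mult_ac)
  qed
  then show ?thesis using * by (simp add: has_bochner_integral_iff)
qed

lemma laplace_ge_1: "t \<ge> 0 \<Longrightarrow> laplace n t \<ge> 1"
proof -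
  assume t: "t \<ge> 0"
  have "(\<integral>g. 1 \<partial>tree_gauss) \<le> laplace n t"
    unfolding laplace_def using t
    by (intro integral_mono integrable_exp_xi) (auto intro!: mult_nonneg_nonneg less_imp_le[OF xi_pos])
  then show ?thesis by (simp add: tree_gauss.prob_space[simplified])
qed

text \<open>Each generation enlarges the argument by the factor \<open>2 / growth\<close> and
  squares the bound.\<close>

lemma laplace_iterate:
  assumes "t \<ge> 0" "laplace n t \<le> exp 1"
  shows "laplace (n + k) (t / (growth / 2) ^ k) \<le> exp (2 ^ k)"
proof (induction k)
  case (Suc k)
  have t: "0 \<le> t / (growth / 2) ^ Suc k" using assms growth(1) by simp
  have t': "0 \<le> t / (growth / 2) ^ k" using assms growth(1) by simp
  have eq: "growth / 2 * (t / (growth / 2) ^ Suc k) = t / (growth / 2) ^ k"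
    using growth(1) by simp
  have "laplace (n + Suc k) (t / (growth / 2) ^ Suc k) \<le> (laplace (n + k) (t / (growth / 2) ^ k))\<^sup>2"
    using laplace_Suc[OF t, of "n + k"] unfolding eq by simp
  also have "\<dots> \<le> (exp (2 ^ k))\<^sup>2"
    using Suc laplace_ge_1[OF t', of "n + k"] by (intro power_mono) auto
  also have "\<dots> = exp (2 ^ Suc k)"
    by (simp add: exp_double[symmetric])
  finally show ?case .
qed (use assms in simp)

text \<open>The function \<open>x \<mapsto> exp (t x) - t x\<close> is increasing on the nonnegative reals, so the
  recursion for \<^term>\<open>xi\<close> also bounds the Laplace transform with its linear term
  removed; that remainder contracts by \<open>exp (\<beta>\<^sup>2) / 2\<close>.\<close>

lemma laplace_remainder_Suc:
  assumes t: "t \<ge> 0"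
  shows "laplace (Suc n) t - t * integral\<^sup>L tree_gauss (xi (Suc n)) \<le>
    (laplace n (growth / 2 * t))\<^sup>2 - growth * t * integral\<^sup>L tree_gauss (xi n)"
proof -
  let ?r = "growth / 2"
  let ?y = "\<lambda>g. xi n (subtree False g) + xi n (subtree True g)"
  have *: "has_bochner_integral tree_gauss (\<lambda>g. exp (?r * t * ?y g)) ((laplace n (?r * t))\<^sup>2)"
    using growth(1) t by (intro has_bochner_integral_exp_pair) simp
  have y: "has_bochner_integral tree_gauss (\<lambda>g. growth * t * avg (xi n) g) (growth * t * integral\<^sup>L tree_gauss (xi n))"
    using avg_sq[OF sq_int_xi[of n]] sq_int_integrable[OF avg_sq(1)[OF sq_int_xi[of n]]]
    by (intro has_bochner_integral_mult_right) (simp add: has_bochner_integral_iff)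
  have mono: "exp a - a \<le> exp b - b" if "0 \<le> a" "a \<le> b" for a b :: real
  proof -
    have "b - a \<le> exp (b - a) - 1" using exp_ge_add_one_self[of "b - a"] by linarith
    also have "\<dots> \<le> exp a * (exp (b - a) - 1)"
      using that mult_right_mono[of 1 "exp a" "exp (b - a) - 1"] by simp
    also have "\<dots> = exp b - exp a"
      by (simp add: right_diff_distrib exp_add[symmetric])
    finally show ?thesis by simp
  qed
  have "(\<integral>g. exp (t * xi (Suc n) g) - t * xi (Suc n) g \<partial>tree_gauss) \<le>
      (\<integral>g. exp (?r * t * ?y g) - growth * t * avg (xi n) g \<partial>tree_gauss)"
  proof (rule integral_mono)
    fix g
    have "growth * t * avg (xi n) g = ?r * t * ?y g" by (simp add: avg_def)
    moreover have "exp (t * xi (Suc n) g) - t * xi (Suc n) g \<le> exp (?r * t * ?y g) - ?r * t * ?y g"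
      using t mult_left_mono[OF xi_Suc_le t, of n g] xi_pos[of "Suc n" g]
      by (intro mono) (auto simp: mult_ac)
    ultimately show "exp (t * xi (Suc n) g) - t * xi (Suc n) g \<le> exp (?r * t * ?y g) - growth * t * avg (xi n) g"
      by (simp only:)
  next
    show "integrable tree_gauss (\<lambda>g. exp (t * xi (Suc n) g) - t * xi (Suc n) g)"
      by (intro Bochner_Integration.integrable_diff integrable_exp_xi t integrable_mult_right
          sq_int_integrable[OF sq_int_xi])
    show "integrable tree_gauss (\<lambda>g. exp (?r * t * ?y g) - growth * t * avg (xi n) g)"
      using * y by (intro Bochner_Integration.integrable_diff) (auto simp: has_bochner_integral_iff)
  qed
  also have "(\<integral>g. exp (t * xi (Suc n) g) - t * xi (Suc n) g \<partial>tree_gauss) =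
      laplace (Suc n) t - t * integral\<^sup>L tree_gauss (xi (Suc n))"
    unfolding laplace_def
    by (subst Bochner_Integration.integral_diff)
       (auto intro!: integrable_exp_xi t sq_int_integrable[OF sq_int_xi])
  also have "(\<integral>g. exp (?r * t * ?y g) - growth * t * avg (xi n) g \<partial>tree_gauss) =
      (laplace n (growth / 2 * t))\<^sup>2 - growth * t * integral\<^sup>L tree_gauss (xi n)"
    using * y by (subst Bochner_Integration.integral_diff) (auto simp: has_bochner_integral_iff)
  finally show ?thesis .
qed

text \<open>Induction on a second order expansion valid on all of \<open>[0, \<delta>]\<close>.
  Keeping the exact mean in the linear term avoids accumulation: the quadratic coefficient is
  inherited with the factor \<open>2 * r\<^sup>2\<close>, less than 1, and \<open>M\<close> enters
  only through the quadratic error.\<close>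

lemma laplace_bounded: "\<exists>\<delta>>0. \<forall>n. laplace n \<delta> \<le> exp 1"
proof -
  obtain M' where M': "\<And>n. integral\<^sup>L tree_gauss (xi n) \<le> M'"
    using xi_mean_bounded by blast
  define M where "M = max M' 0"
  have M: "integral\<^sup>L tree_gauss (xi n) \<le> M" "M \<ge> 0" for n
    using M'[of n] by (auto simp: M_def)
  define \<mu> where "\<mu> n = integral\<^sup>L tree_gauss (xi n)" for n
  have \<mu>: "0 \<le> \<mu> n" "\<mu> n \<le> M" for n
    unfolding \<mu>_def by (auto intro!: M Bochner_Integration.integral_nonneg less_imp_le[OF xi_pos])
  define r where "r = growth / 2"
  \<comment> \<open>\<open>16 * M\<^sup>2\<close> makes \<open>a\<^sup>2\<close> a small part of
    \<open>K * t\<^sup>2\<close>, and the summand 1 covers generation 0. The choice of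
    \<open>\<delta>\<close> makes \<open>a\<close> and \<open>b\<close> at most 1/32.\<close>
  define K where "K = 16 * M\<^sup>2 + 1"
  define \<delta> where "\<delta> = 1 / (32 * K)"
  have K: "K \<ge> 1" "M\<^sup>2 \<le> K / 16" by (auto simp: K_def)
  have MK: "M \<le> K"
    using zero_le_power2[of "4 * M - 1"] by (simp add: K_def power2_eq_square algebra_simps) (use M(2) in linarith)
  have \<delta>: "0 < \<delta>" "\<delta> \<le> 1 / 32" "K * \<delta> = 1 / 32"
    using K by (auto simp: \<delta>_def field_simps)
  have r: "0 < r" "r < 1" "2 * r\<^sup>2 \<le> 3 / 4"
    using growth exp_beta_sq by (auto simp: r_def power_divide)
  have main: "laplace n t \<le> 1 + t * \<mu> n + K * t\<^sup>2" if "0 \<le> t" "t \<le> \<delta>" for n t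
    using that
  proof (induction n arbitrary: t)
    case 0
    have "exp t \<le> 1 + t + t\<^sup>2"
      using 0 \<delta> by (intro exp_bound) auto
    also have "t\<^sup>2 \<le> K * t\<^sup>2"
      using K mult_right_mono[of 1 K "t\<^sup>2"] by simp
    finally show ?case
      by (simp add: laplace_def \<mu>_def xi_def[abs_def] tree_gauss.prob_space[simplified])
  next
    case (Suc n)
    define a where "a = r * t * \<mu> n"
    define b where "b = K * r\<^sup>2 * t\<^sup>2"
    have rt: "0 \<le> r * t" "r * t \<le> t"
      using r Suc.prems mult_right_mono[of r 1 t] by auto
    have a0: "0 \<le> a" using rt \<mu> by (simp add: a_def)
    have b0: "0 \<le> b" using K by (simp add: b_def)
    have "laplace n (r * t) \<le> 1 + a + b"
      using Suc.IH[of "r * t"] rt Suc.prems by (simp add: a_def b_def power_mult_distrib mult_ac)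
    then have "(laplace n (r * t))\<^sup>2 \<le> (1 + a + b)\<^sup>2"
      using laplace_ge_1[OF rt(1), of n] by (intro power_mono) auto
    moreover have "laplace (Suc n) t - t * \<mu> (Suc n) \<le> (laplace n (r * t))\<^sup>2 - 2 * a"
      using laplace_remainder_Suc[OF Suc.prems(1), of n] by (simp add: r_def a_def \<mu>_def)
    moreover have "(1 + a + b)\<^sup>2 - 2 * a = 1 + a\<^sup>2 + 2 * b + 2 * a * b + b\<^sup>2"
      by (simp add: power2_eq_square algebra_simps)
    \<comment> \<open>In units of \<open>K * t\<^sup>2\<close>: at most 1/16 for
      \<open>a\<^sup>2\<close>, 3/4 for \<open>2 * b\<close>, and less than 1/16 for the other two
      terms, which are at most \<open>3 / 32 * b\<close>.\<close>
    moreover have "a\<^sup>2 + 2 * b + 2 * a * b + b\<^sup>2 \<le> K * t\<^sup>2"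
    proof -
      have at: "a \<le> t * M"
        unfolding a_def using rt \<mu>[of n] by (intro mult_mono) auto
      have "t * M \<le> \<delta> * K"
        using Suc.prems MK M(2) by (intro mult_mono) auto
      with at \<delta> have a1: "a \<le> 1 / 32" by (simp add: mult_ac)
      have "a\<^sup>2 \<le> (t * M)\<^sup>2"
        using at a0 by (intro power_mono)
      also have "\<dots> \<le> K / 16 * t\<^sup>2"
        using mult_right_mono[OF K(2), of "t\<^sup>2"] by (simp add: power_mult_distrib mult_ac)
      finally have 1: "a\<^sup>2 \<le> K / 16 * t\<^sup>2" .
      have bt: "2 * b \<le> 3 / 4 * (K * t\<^sup>2)"
        using mult_right_mono[OF r(3), of "K * t\<^sup>2"] K by (simp add: b_def mult_ac)
      have Kt: "0 \<le> K * t\<^sup>2" using K by simp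
      have "2 * a * b \<le> 2 * (1 / 32) * b"
        using a1 b0 by (intro mult_right_mono) auto
      then have 2: "2 * a * b \<le> 1 / 16 * b" by simp
      have "K * t\<^sup>2 \<le> K * (\<delta> * \<delta>)"
        using Suc.prems K unfolding power2_eq_square by (intro mult_left_mono mult_mono) auto
      also have "\<dots> = 1 / 32 * \<delta>" using \<delta>(3) by simp
      also have "\<dots> \<le> 1 / 32" using \<delta>(2) by simp
      finally have "b \<le> 1 / 32" using bt b0 by linarith
      then have "b * b \<le> 1 / 32 * b" using b0 by (intro mult_right_mono) auto
      then have 3: "b\<^sup>2 \<le> 1 / 32 * b" by (simp add: power2_eq_square)
      show ?thesis using 1 2 3 bt b0 Kt by linarith
    qed
    ultimately show ?case by linarith
  qed
  have "laplace n \<delta> \<le> exp 1" for n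
  proof -
    have "\<delta> * \<mu> n \<le> \<delta> * K"
      using \<delta> \<mu>[of n] MK by (intro mult_left_mono) auto
    moreover have "K * \<delta>\<^sup>2 = K * \<delta> * \<delta>" by (simp add: power2_eq_square)
    ultimately have "laplace n \<delta> \<le> 1 + 1 / 32 + 1 / 32 * \<delta>"
      using main[of \<delta> n] \<delta> by (simp add: mult_ac)
    also have "\<dots> \<le> 1 + 1" using \<delta> by simp
    also have "\<dots> \<le> exp 1" by (rule exp_ge_add_one_self)
    finally show ?thesis .
  qed
  with \<delta>(1) show ?thesis by blast
qed

section \<open>Chernoff bound and passage to the limit\<close>

lemma prob_avg_der_tail:
  assumes \<delta>: "\<delta> > 0" "\<And>n. laplace n \<delta> \<le> exp 1"
    and x: "2 * growth ^ k \<le> \<delta> * (exp 1 * \<beta>) * x"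
  shows "measure tree_gauss {g. avg (der (n + k)) g < - x} \<le> exp (- (2 ^ k))"
proof -
  \<comment> \<open>The argument \<open>?t\<close> is \<open>\<delta>\<close> enlarged over
    \<open>k\<close> generations, where the transform is still at most
    \<open>exp (2 ^ k)\<close>.\<close>
  let ?c = "exp 1 * \<beta>" and ?t = "\<delta> / (growth / 2) ^ k"
  let ?y = "\<lambda>g. xi (n + k) (subtree False g) + xi (n + k) (subtree True g)"
  have t: "?t > 0" using \<delta> growth(1) by simp
  have c: "?c > 0" using beta_pos by simp
  have int: "has_bochner_integral tree_gauss (\<lambda>g. exp (?t * ?y g)) ((laplace (n + k) ?t)\<^sup>2)"
    using t by (intro has_bochner_integral_exp_pair) simp
  have L: "laplace (n + k) ?t \<le> exp (2 ^ k)"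
    using \<delta> by (intro laplace_iterate) auto
  have [measurable]: "(\<lambda>g. xi (n + k) (subtree b g)) \<in> borel_measurable tree_gauss" for b
    by (rule measurable_compose[OF measurable_subtree measurable_xi])
  have m: "{g. exp (?t * ?y g) \<ge> exp (?t * (2 * ?c * x))} \<in> sets tree_gauss"
    using borel_measurable_le[of "\<lambda>_. exp (?t * (2 * ?c * x))" tree_gauss "\<lambda>g. exp (?t * ?y g)"] by simp
  have "measure tree_gauss {g. avg (der (n + k)) g < - x} \<le>
      measure tree_gauss {g. exp (?t * ?y g) \<ge> exp (?t * (2 * ?c * x))}"
  proof (intro tree_gauss.finite_measure_mono m subsetI CollectI)
    fix g assume "g \<in> {g. avg (der (n + k)) g < - x}"
    moreover have "avg (der (n + k)) g \<ge> - (?y g / (2 * ?c))"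
    proof -
      have "(a + b) / (2 * ?c) = (a / ?c + b / ?c) / 2" for a b :: real
        by (simp add: add_divide_distrib)
      moreover have "- ((a + b) / 2) \<le> (d + e) / 2" if "- a \<le> d" "- b \<le> e" for a b d e :: real
        unfolding minus_divide_left minus_add_distrib
        by (rule divide_right_mono[OF add_mono[OF that]]) simp
      ultimately show ?thesis
        using der_ge[of "n + k" "subtree False g"] der_ge[of "n + k" "subtree True g"]
        unfolding avg_def minus_divide_left[symmetric] by simp
    qed
    ultimately have "x \<le> ?y g / (2 * ?c)" by simp
    then have "2 * ?c * x \<le> ?y g" using c by (simp add: field_simps)
    from mult_left_mono[OF this, of ?t] t
    show "exp (?t * (2 * ?c * x)) \<le> exp (?t * ?y g)" by simp
  qed
  also have "\<dots> \<le> (\<integral>g. exp (?t * ?y g) \<partial>tree_gauss) / exp (?t * (2 * ?c * x))"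
    using integral_Markov_inequality_measure[of tree_gauss "\<lambda>g. exp (?t * ?y g)" "{}" "exp (?t * (2 * ?c * x))"]
      int by (simp add: has_bochner_integral_iff)
  also have "(\<integral>g. exp (?t * ?y g) \<partial>tree_gauss) = (laplace (n + k) ?t)\<^sup>2"
    using int by (simp add: has_bochner_integral_iff)
  also have "(laplace (n + k) ?t)\<^sup>2 / exp (?t * (2 * ?c * x)) \<le> (exp (2 ^ k))\<^sup>2 / exp (?t * (2 * ?c * x))"
    using L laplace_ge_1[OF less_imp_le[OF t], of "n + k"] by (intro divide_right_mono power_mono) auto
  also have "\<dots> = exp (2 * 2 ^ k - ?t * (2 * ?c * x))"
    by (simp only: exp_diff exp_double)
  \<comment> \<open>The two subtrees contribute \<open>2 * 2 ^ k\<close> to the exponent; the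
    hypothesis on \<open>x\<close> makes the subtracted term at least
    \<open>4 * 2 ^ k\<close>.\<close>
  also have "\<dots> \<le> exp (- (2 ^ k))"
  proof -
    have "2 * (2 * 2 ^ k) = 2 * ((2 * growth ^ k) / (growth / 2) ^ k)"
      using growth(1) by (simp add: power_divide)
    also have "\<dots> \<le> 2 * ((\<delta> * ?c * x) / (growth / 2) ^ k)"
      using x growth(1) by (intro mult_left_mono divide_right_mono) auto
    also have "\<dots> = ?t * (2 * ?c * x)" by simp
    finally have *: "2 * (2 * 2 ^ k) \<le> ?t * (2 * ?c * x)" .
    have "2 * v - w \<le> - v" if "2 * (2 * v) \<le> w" "0 \<le> v" for v w :: real
      using that by linarith
    from this[OF *] show ?thesis by simp
  qed
  finally show ?thesis .
qed

text \<open>The source of the exponent: the Chernoff bound at level of order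
  \<open>growth ^ k\<close> decays like \<open>exp (- (2 ^ k))\<close>, and \<open>2 ^ k\<close> is
  the power \<gamma> of \<open>growth ^ k\<close>.\<close>

lemma growth_powr: "growth powr ((beta_c / \<beta>)\<^sup>2) = 2"
proof -
  have "growth powr ((beta_c / \<beta>)\<^sup>2) = exp ((beta_c / \<beta>)\<^sup>2 * (\<beta>\<^sup>2 / 2))"
    by (simp add: growth_def powr_def)
  also have "(beta_c / \<beta>)\<^sup>2 * (\<beta>\<^sup>2 / 2) = ln 2"
    using beta_pos by (simp add: power_divide beta_c_def)
  finally show ?thesis by simp
qed

text \<open>Where the martingale converges, a limit strictly below \<open>- x\<close> forces all
  late values below \<open>- x\<close>, so the event is covered by the increasing sets
  \<open>S j\<close>. The shift \<open>k\<close> matches the generation at which the Chernoff bound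
  starts.\<close>

lemma prob_limit_tail:
  assumes bound: "\<And>n. measure tree_gauss {g. avg (der (n + k)) g < - x} \<le> b"
  shows "measure tree_gauss {g. lim (\<lambda>n. avg (der n) g) < - x} \<le> b"
proof -
  define S where "S j = {g. \<forall>n\<ge>j. avg (der (n + k)) g < - x}" for j
  have [measurable]: "avg (der n) \<in> borel_measurable tree_gauss" for n by simp
  have S [measurable]: "S j \<in> sets tree_gauss" for j
  proof -
    have "S j = {g \<in> space tree_gauss. \<forall>n\<ge>j. avg (der (n + k)) g < - x}" by (simp add: S_def)
    also have "\<dots> \<in> sets tree_gauss" by measurable
    finally show ?thesis .
  qed
  have lim: "{g. lim (\<lambda>n. avg (der n) g) < - x} \<in> sets tree_gauss"
  proof -
    have "{g \<in> space tree_gauss. lim (\<lambda>n. avg (der n) g) < - x} \<in> sets tree_gauss" by measurable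
    then show ?thesis by simp
  qed
  have "AE g in tree_gauss. g \<in> {g. lim (\<lambda>n. avg (der n) g) < - x} \<longrightarrow> g \<in> (\<Union>j. S j)"
    using AE_convergent_avg_der
  proof eventually_elim
    case (elim g)
    show ?case
    proof
      assume "g \<in> {g. lim (\<lambda>n. avg (der n) g) < - x}"
      moreover have "(\<lambda>n. avg (der n) g) \<longlonglongrightarrow> lim (\<lambda>n. avg (der n) g)"
        using elim by (simp add: convergent_LIMSEQ_iff)
      ultimately have "eventually (\<lambda>n. avg (der n) g < - x) sequentially"
        by (auto intro: order_tendstoD)
      then obtain N where "\<And>n. n \<ge> N \<Longrightarrow> avg (der n) g < - x"
        by (auto simp: eventually_sequentially)
      then show "g \<in> (\<Union>j. S j)" by (auto simp: S_def intro!: exI[of _ N])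
    qed
  qed
  then have "measure tree_gauss {g. lim (\<lambda>n. avg (der n) g) < - x} \<le> measure tree_gauss (\<Union>j. S j)"
    by (intro tree_gauss.finite_measure_mono_AE) auto
  also have "\<dots> \<le> b"
  proof (rule LIMSEQ_le_const2)
    show "(\<lambda>j. measure tree_gauss (S j)) \<longlonglongrightarrow> measure tree_gauss (\<Union>j. S j)"
    proof (rule tree_gauss.finite_Lim_measure_incseq)
      show "range S \<subseteq> sets tree_gauss" using S by auto
      show "incseq S" by (auto simp: S_def incseq_def)
    qed
    have "measure tree_gauss (S j) \<le> b" for j
    proof -
      have "{g. avg (der (j + k)) g < - x} \<in> sets tree_gauss"
        using borel_measurable_less[of "avg (der (j + k))" tree_gauss "\<lambda>_. - x"] by simp
      then have "measure tree_gauss (S j) \<le> measure tree_gauss {g. avg (der (j + k)) g < - x}"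
        by (intro tree_gauss.finite_measure_mono) (auto simp: S_def)
      with bound[of j] show ?thesis by simp
    qed
    then show "\<exists>N. \<forall>j\<ge>N. measure tree_gauss (S j) \<le> b" by blast
  qed
  finally show ?thesis .
qed

lemma tail_bound:
  assumes \<gamma>: "\<gamma> = (beta_c / \<beta>)\<^sup>2"
  shows "\<exists>c>0. \<exists>C>0. \<forall>x\<ge>0.
    measure tree_gauss {g. lim (\<lambda>n. avg (der n) g) < - x} \<le> C * exp (- c * x powr \<gamma>)"
proof -
  obtain \<delta> where \<delta>: "\<delta> > 0" "\<And>n. laplace n \<delta> \<le> exp 1"
    using laplace_bounded by blast
  \<comment> \<open>With this scaling the hypothesis of \<open>prob_avg_der_tail\<close> reads
    \<open>growth ^ k \<le> \<kappa> * x\<close>.\<close>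
  define \<kappa> where "\<kappa> = \<delta> * (exp 1 * \<beta>) / 2"
  have \<kappa>: "\<kappa> > 0" using \<delta> beta_pos by (simp add: \<kappa>_def)
  have \<gamma>0: "\<gamma> \<ge> 0" by (simp add: \<gamma>)
  have gp: "growth powr \<gamma> = 2" unfolding \<gamma> by (rule growth_powr)
  \<comment> \<open>Dividing by \<open>growth\<close> pays for rounding the logarithm down to an
    integer; raised to \<gamma> it is the factor 2.\<close>
  define c where "c = (\<kappa> / growth) powr \<gamma>"
  have c: "c > 0" using \<kappa> growth(1) by (simp add: c_def)
  have cx: "c * x powr \<gamma> = (\<kappa> * x) powr \<gamma> / 2" if "x \<ge> 0" for x
    using that \<kappa> growth(1) by (simp add: c_def powr_mult powr_divide gp)
  have "measure tree_gauss {g. lim (\<lambda>n. avg (der n) g) < - x} \<le> exp 1 * exp (- c * x powr \<gamma>)"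
    if x: "x \<ge> 0" for x
  proof (cases "\<kappa> * x < 1")
    case True
    \<comment> \<open>For small \<open>x\<close>, \<open>c * x powr \<gamma>\<close> is at most 1/2,
      so the constant \<open>exp 1\<close> makes the claimed bound at least 1.\<close>
    have "(\<kappa> * x) powr \<gamma> \<le> 1 powr \<gamma>"
      using True x \<kappa> \<gamma>0 by (intro powr_mono2) auto
    then have "0 \<le> 1 + - c * x powr \<gamma>"
      using cx[OF x] by simp
    then have "1 \<le> exp 1 * exp (- c * x powr \<gamma>)"
      unfolding exp_add[symmetric] by simp
    then show ?thesis
      using tree_gauss.prob_le_1 order_trans by blast
  next
    case False
    define k where "k = nat \<lfloor>log growth (\<kappa> * x)\<rfloor>"
    have log0: "0 \<le> log growth (\<kappa> * x)" using False growth(1) by simp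
    have k: "real k \<le> log growth (\<kappa> * x)" "log growth (\<kappa> * x) < real k + 1"
      using log0 unfolding k_def by linarith+
    have "growth ^ k = growth powr real k"
      using growth(1) by (simp add: powr_realpow)
    also have "\<dots> \<le> growth powr log growth (\<kappa> * x)"
      using k(1) growth(1) by (intro powr_mono) auto
    also have "\<dots> = \<kappa> * x" using False growth(1) by simp
    finally have lower: "growth ^ k \<le> \<kappa> * x" .
    have "\<kappa> * x = growth powr log growth (\<kappa> * x)"
      using False growth(1) by simp
    also have "\<dots> \<le> growth powr (real k + 1)"
      using k(2) growth(1) by (intro powr_mono) auto
    finally have "(\<kappa> * x) powr \<gamma> \<le> (growth powr (real k + 1)) powr \<gamma>"
      using \<gamma>0 False by (intro powr_mono2) auto
    also have "\<dots> = (growth powr \<gamma>) powr (real k + 1)"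
      by (simp add: powr_powr mult.commute)
    also have "\<dots> = 2 * 2 ^ k"
      by (simp add: gp powr_add powr_realpow)
    finally have "c * x powr \<gamma> \<le> 2 ^ k" using cx[OF x] by simp
    then have e: "exp (- (2 ^ k)) \<le> exp (- c * x powr \<gamma>)" by simp
    have "measure tree_gauss {g. lim (\<lambda>n. avg (der n) g) < - x} \<le> exp (- (2 ^ k))"
    proof (rule prob_limit_tail)
      show "measure tree_gauss {g. avg (der (n + k)) g < - x} \<le> exp (- (2 ^ k))" for n
        using lower by (intro prob_avg_der_tail[OF \<delta>]) (auto simp: \<kappa>_def)
    qed
    also have "\<dots> \<le> 1 * exp (- c * x powr \<gamma>)" using e by simp
    also have "\<dots> \<le> exp 1 * exp (- c * x powr \<gamma>)"
      by (intro mult_right_mono) auto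
    finally show ?thesis .
  qed
  with c show ?thesis by (intro exI[of _ c] conjI exI[of _ "exp 1"]) auto
qed

end

section \<open>Transfer to the branching random walk\<close>

lemma walk_Nil [simp]: "walk G [] \<omega> = 0"
  by (auto simp: walk_def intro!: sum.neutral)

lemma walk_Cons: "walk G (b # u) \<omega> = G [b] \<omega> + walk (subtree b G) u \<omega>"
proof -
  have fin: "finite {v. strict_prefix [] v \<and> prefix v u}"
    by (rule finite_subset[of _ "set (prefixes u)"]) (auto simp: in_set_prefixes)
  have "{v. strict_prefix [] v \<and> prefix v (b # u)} =
      insert [b] (Cons b ` {v. strict_prefix [] v \<and> prefix v u})"
    by (auto simp: prefix_Cons strict_prefix_def)
  then have "walk G (b # u) \<omega> = G [b] \<omega> + (\<Sum>v\<in>Cons b ` {v. strict_prefix [] v \<and> prefix v u}. G v \<omega>)"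
    using fin by (simp add: walk_def) (subst sum.insert, auto)
  also have "(\<Sum>v\<in>Cons b ` {v. strict_prefix [] v \<and> prefix v u}. G v \<omega>) = walk (subtree b G) u \<omega>"
    by (simp add: walk_def subtree_def sum.reindex)
  finally show ?thesis .
qed

lemma sum_words_Suc:
  "(\<Sum>u | length u = Suc n. f u) =
    (\<Sum>u | length u = n. f (False # u)) + (\<Sum>u | length u = n. f (True # u) :: real)"
proof -
  have fin: "finite {u :: bool list. length u = n}"
    using finite_lists_length_eq[of "UNIV :: bool set" n] by simp
  have "{u :: bool list. length u = Suc n} =
      Cons False ` {u. length u = n} \<union> Cons True ` {u. length u = n}"
    by (auto simp: length_Suc_conv image_iff)
  then show ?thesis
    by (simp, subst sum.union_disjoint) (auto simp: fin sum.reindex)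
qed

text \<open>Independence amounts to the joint law being the product of the marginals, which all
  equal \<open>gauss\<close>.\<close>

lemma distr_iid_std_gaussian:
  assumes "prob_space M" "iid_std_gaussian M G"
  shows "(\<lambda>\<omega> v. G v \<omega>) \<in> measurable M tree_gauss"
    and "distr M tree_gauss (\<lambda>\<omega> v. G v \<omega>) = tree_gauss"
proof -
  interpret prob_space M by fact
  have indep: "indep_vars (\<lambda>_. borel) G UNIV"
    and dist: "\<And>v. distributed M lborel (G v) std_normal_density"
    using assms(2) by (auto simp: iid_std_gaussian_def)
  have G: "G v \<in> borel_measurable M" for v
    using distributed_measurable[OF dist[of v]] by simp
  show "(\<lambda>\<omega> v. G v \<omega>) \<in> measurable M tree_gauss"
    by (rule measurable_into_tree) (rule G)
  have eq: "distr M borel (G v) = gauss" for v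
  proof -
    have "distr M borel (G v) = distr M lborel (G v)"
      by (rule distr_cong) auto
    then show ?thesis
      using distributed_distr_eq_density[OF dist[of v]] by (simp add: gauss_def)
  qed
  have "distr M (PiM UNIV (\<lambda>_. borel)) (\<lambda>\<omega>. \<lambda>v\<in>UNIV. G v \<omega>) = PiM UNIV (\<lambda>v. distr M borel (G v))"
    using indep_vars_iff_distr_eq_PiM[of UNIV G "\<lambda>_. borel"] G indep by simp
  then have "distr M (PiM UNIV (\<lambda>_. borel)) (\<lambda>\<omega> v. G v \<omega>) = tree_gauss"
    by (simp add: eq tree_gauss_def restrict_UNIV)
  moreover have "sets (PiM UNIV (\<lambda>_. borel)) = sets tree_gauss"
    unfolding tree_gauss_def by (rule sets_PiM_cong) simp_all
  ultimately show "distr M tree_gauss (\<lambda>\<omega> v. G v \<omega>) = tree_gauss"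
    by (metis distr_cong)
qed

section \<open>Identification of the martingales\<close>

context branching_walk
begin

text \<open>Both identities go through one induction, since \<open>der_step\<close> involves
  \<open>cas\<close>, and for arbitrary \<open>G\<close>, since the hypothesis is applied to both
  subtrees. The weight on a first edge is the root variable of the subtree below it.\<close>

lemma cas_der_eq:
  fixes G :: "bool list \<Rightarrow> 'a \<Rightarrow> real"
  shows "avg (cas n) (\<lambda>v. G v \<omega>) = 1 / 2 ^ n * (\<Sum>u | length u = n. exp (\<beta> * walk G u \<omega> - \<beta>\<^sup>2 / 2 * real n)) \<and>
    avg (der n) (\<lambda>v. G v \<omega>) = deriv_martingale G \<beta> n \<omega>"
proof (induction n arbitrary: G)
  case 0
  then show ?case by (simp add: avg_def deriv_martingale_def)
next
  case (Suc n)
  let ?G = "\<lambda>b. subtree b G"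
  let ?e = "\<lambda>H u. exp (\<beta> * walk H u \<omega> - \<beta>\<^sup>2 / 2 * real n)"
  have sub: "subtree b (\<lambda>v. G v \<omega>) = (\<lambda>v. ?G b v \<omega>)" for b
    by (simp add: subtree_def)
  have root: "(\<lambda>v. ?G b v \<omega>) [] = G [b] \<omega>" for b
    by (simp add: subtree_def)
  have e: "exp (\<beta> * walk G (b # u) \<omega> - \<beta>\<^sup>2 / 2 * real (Suc n)) = weight (G [b] \<omega>) * ?e (?G b) u" for b u
    unfolding weight_def exp_add[symmetric] by (simp add: walk_Cons algebra_simps add_divide_distrib)
  have cas: "cas (Suc n) (\<lambda>v. ?G b v \<omega>) = weight (G [b] \<omega>) * (1 / 2 ^ n * (\<Sum>u | length u = n. ?e (?G b) u))" for b
    using Suc.IH[of "?G b"] by (simp add: cas_step_def root)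
  have der: "der (Suc n) (\<lambda>v. ?G b v \<omega>) = weight (G [b] \<omega>) *
      (1 / 2 ^ n * (\<Sum>u | length u = n. ?e (?G b) u * (walk G (b # u) \<omega> - \<beta> * real (Suc n))))" for b
  proof -
    have "?e (?G b) u * (walk G (b # u) \<omega> - \<beta> * real (Suc n)) =
        ?e (?G b) u * (walk (?G b) u \<omega> - \<beta> * real n) + (G [b] \<omega> - \<beta>) * ?e (?G b) u" for u
      by (simp add: walk_Cons algebra_simps)
    then have "(\<Sum>u | length u = n. ?e (?G b) u * (walk G (b # u) \<omega> - \<beta> * real (Suc n))) =
        (\<Sum>u | length u = n. ?e (?G b) u * (walk (?G b) u \<omega> - \<beta> * real n)) +
        (G [b] \<omega> - \<beta>) * (\<Sum>u | length u = n. ?e (?G b) u)"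
      by (simp add: sum.distrib sum_distrib_left)
    then show ?thesis
      using Suc.IH[of "?G b"] by (simp add: der_step_def root deriv_martingale_def distrib_left mult_ac)
  qed
  show ?case
  proof
    show "avg (cas (Suc n)) (\<lambda>v. G v \<omega>) =
        1 / 2 ^ Suc n * (\<Sum>u | length u = Suc n. exp (\<beta> * walk G u \<omega> - \<beta>\<^sup>2 / 2 * real (Suc n)))"
      unfolding avg_def sub cas sum_words_Suc e sum_distrib_left[symmetric] by (simp add: algebra_simps)
    show "avg (der (Suc n)) (\<lambda>v. G v \<omega>) = deriv_martingale G \<beta> (Suc n) \<omega>"
      unfolding avg_def sub der deriv_martingale_def sum_words_Suc e mult.assoc sum_distrib_left[symmetric]
      by (simp add: algebra_simps)
  qed
qed

end

theorem theorem1p2: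
  fixes M :: "'a measure" and G :: "bool list \<Rightarrow> 'a \<Rightarrow> real" and \<beta> \<gamma> :: real
  assumes "prob_space M"
    and "iid_std_gaussian M G"
    and "\<beta> \<in> {0<..<beta_c / 2}"
    and "\<gamma> = (beta_c / \<beta>)\<^sup>2"
  shows "\<exists>c'>0. \<exists>C'>0. \<forall>x\<ge>0.
    measure M {\<omega> \<in> space M. deriv_limit G \<beta> \<omega> < - x} \<le> C' * exp (- c' * x powr \<gamma>)"
proof -
  interpret branching_walk \<beta>
    using assms(3) by unfold_locales auto
  note G = distr_iid_std_gaussian[OF assms(1,2)]
  have "measure M {\<omega> \<in> space M. deriv_limit G \<beta> \<omega> < - x} =
      measure tree_gauss {g. lim (\<lambda>n. avg (der n) g) < - x}" for x
  proof -
    let ?S = "{g. lim (\<lambda>n. avg (der n) g) < - x}"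
    have "{g \<in> space tree_gauss. lim (\<lambda>n. avg (der n) g) < - x} \<in> sets tree_gauss"
      by measurable
    then have "measure (distr M tree_gauss (\<lambda>\<omega> v. G v \<omega>)) ?S = measure M ((\<lambda>\<omega> v. G v \<omega>) -` ?S \<inter> space M)"
      by (intro measure_distr G(1)) simp
    \<comment> \<open>The events agree pointwise, also where the martingale diverges: both are
      stated through \<open>lim\<close> of the same sequence.\<close>
    also have "(\<lambda>\<omega> v. G v \<omega>) -` ?S \<inter> space M = {\<omega> \<in> space M. deriv_limit G \<beta> \<omega> < - x}"
      by (auto simp: deriv_limit_def cas_der_eq)
    finally show ?thesis by (simp add: G(2))
  qed
  then show ?thesis
    using tail_bound[OF assms(4)] by simp
qed

end
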